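(* Let $\Gamma,\Gamma'$ be finite simplicial graphs and let $p$ be a prime. Then the pro-$p$ completions of the right-angled Artin groups $A(\Gamma)$ and $A(\Gamma')$ are isomorphic as topological groups, $\widehat{A(\Gamma)}_{(p)}\cong\widehat{A(\Gamma')}_{(p)}$, if and only if $\Gamma\cong\Gamma'$ as graphs.
   Context: A finite simplicial graph is a finite graph with no loops and no multiple edges. For a finite simplicial graph $\Gamma$ with vertex set $V(\Gamma)$, the right-angled Artin group $A(\Gamma)$ is the group with generating set $V(\Gamma)$ and with a relation $vw=wv$ for each pair of vertices $v,w$ spanning an edge of $\Gamma$ (and no other relations). For a discrete group $G$ and a prime $p$, the pro-$p$ completion is $\widehat{G}_{(p)}=\varprojlim_N G/N$, where $N$ ranges over the finite-index normal subgroups of $G$ such that $G/N$ is a $p$-group, with the inverse limit topology. *)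

theory Defs
  imports
    "HOL-Analysis.Function_Topology"
    "HOL-Algebra.Product_Groups"
    "HOL-Computational_Algebra.Primes"
    "Graph_Theory.Graph_Theory"
begin

section \<open>Groups given by generators and relations\<close>

text \<open>
  The letter \<open>(s, True)\<close> stands for the generator \<open>s\<close> and \<open>(s, False)\<close> for its inverse.
  A pair \<open>(l, r) \<in> R\<close> stands for the relation \<open>l = r\<close>.
\<close>

type_synonym 'a word = "('a \<times> bool) list"

definition words :: "'a set \<Rightarrow> 'a word set" where
  "words S = lists (S \<times> UNIV)"

inductive word_eq :: "'a set \<Rightarrow> ('a word \<times> 'a word) set \<Rightarrow> 'a word \<Rightarrow> 'a word \<Rightarrow> bool"
  for S :: "'a set" and R :: "('a word \<times> 'a word) set" where
  refl: "w \<in> words S \<Longrightarrow> word_eq S R w w"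
| sym: "word_eq S R v w \<Longrightarrow> word_eq S R w v"
| trans: "word_eq S R u v \<Longrightarrow> word_eq S R v w \<Longrightarrow> word_eq S R u w"
| cancel: "u \<in> words S \<Longrightarrow> w \<in> words S \<Longrightarrow> s \<in> S \<Longrightarrow>
    word_eq S R (u @ [(s, b), (s, \<not> b)] @ w) (u @ w)"
| relation: "u \<in> words S \<Longrightarrow> w \<in> words S \<Longrightarrow> l \<in> words S \<Longrightarrow> r \<in> words S \<Longrightarrow> (l, r) \<in> R \<Longrightarrow>
    word_eq S R (u @ l @ w) (u @ r @ w)"

definition presented_group :: "'a set \<Rightarrow> ('a word \<times> 'a word) set \<Rightarrow> 'a word set monoid" where
  "presented_group S R =
    \<lparr>carrier = words S // {(v, w). word_eq S R v w},
     monoid.mult = (\<lambda>A B. {w. \<exists>a\<in>A. \<exists>b\<in>B. word_eq S R (a @ b) w}),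
     one = {w. word_eq S R [] w}\<rparr>"

lemma words_append [simp]: "u @ v \<in> words S \<longleftrightarrow> u \<in> words S \<and> v \<in> words S"
  by (auto simp: words_def)

lemma words_Nil [simp]: "[] \<in> words S"
  by (auto simp: words_def)

lemma word_eq_words: "word_eq S R v w \<Longrightarrow> v \<in> words S \<and> w \<in> words S"
  by (induction rule: word_eq.induct) (auto simp: words_def)

lemma word_eq_context:
  assumes "word_eq S R v w" "x \<in> words S" "y \<in> words S"
  shows "word_eq S R (x @ v @ y) (x @ w @ y)"
  using assms
proof (induction rule: word_eq.induct)
  case (refl w)
  then show ?case by (auto intro: word_eq.refl)
next
  case (sym v w)
  then show ?case by (auto intro: word_eq.sym)
next
  case (trans u v w)
  then show ?case by (blast intro: word_eq.trans)
next
  case (cancel u w s b)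
  then show ?case
    using word_eq.cancel[of "x @ u" S "w @ y" s R b] by simp
next
  case (relation u w l r)
  then show ?case
    using word_eq.relation[of "x @ u" S "w @ y" l r R] by simp
qed

lemma word_eq_append:
  assumes "word_eq S R a a'" "word_eq S R b b'"
  shows "word_eq S R (a @ b) (a' @ b')"
  using word_eq_context[OF assms(1), of "[]" b] word_eq_context[OF assms(2), of a' "[]"]
    word_eq_words[OF assms(1)] word_eq_words[OF assms(2)]
  by (auto intro: word_eq.trans)

definition word_class :: "'a set \<Rightarrow> ('a word \<times> 'a word) set \<Rightarrow> 'a word \<Rightarrow> 'a word set" where
  "word_class S R v = {w. word_eq S R v w}"

lemma word_class_eq_iff:
  assumes "v \<in> words S"
  shows "word_class S R v = word_class S R w \<longleftrightarrow> word_eq S R v w"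
  using assms unfolding word_class_def
  by (blast intro: word_eq.refl word_eq.sym word_eq.trans)

lemma carrier_presented_group: "carrier (presented_group S R) = word_class S R ` words S"
  by (auto simp: presented_group_def quotient_def word_class_def)

lemma one_presented_group: "\<one>\<^bsub>presented_group S R\<^esub> = word_class S R []"
  by (simp add: presented_group_def word_class_def)

lemma mult_presented_group:
  assumes "a \<in> words S" "b \<in> words S"
  shows "word_class S R a \<otimes>\<^bsub>presented_group S R\<^esub> word_class S R b = word_class S R (a @ b)"
proof -
  have "\<And>w. (\<exists>a'. word_eq S R a a' \<and> (\<exists>b'. word_eq S R b b' \<and> word_eq S R (a' @ b') w))
      \<longleftrightarrow> word_eq S R (a @ b) w"
    using assms by (blast intro: word_eq.refl word_eq.trans word_eq_append)
  then show ?thesis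
    by (auto simp: presented_group_def word_class_def)
qed

lemma word_eq_inverse:
  assumes "w \<in> words S"
  shows "word_eq S R (rev (map (apsnd Not) w) @ w) []"
  using assms
proof (induction w)
  case Nil
  then show ?case by (auto intro: word_eq.refl)
next
  case (Cons x w)
  obtain s b where x: "x = (s, b)" by (cases x)
  have w: "w \<in> words S" "s \<in> S" "rev (map (apsnd Not) w) \<in> words S"
    using Cons.prems x by (fastforce simp: words_def)+
  then show ?case
    using word_eq.cancel[of "rev (map (apsnd Not) w)" S w s R "\<not> b"] Cons.IH x
    by (auto intro: word_eq.trans)
qed

lemma group_presented_group: "group (presented_group S R)"
proof (rule groupI)
  fix x y z
  assume "x \<in> carrier (presented_group S R)" "y \<in> carrier (presented_group S R)"
    "z \<in> carrier (presented_group S R)"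
  then show "x \<otimes>\<^bsub>presented_group S R\<^esub> y \<otimes>\<^bsub>presented_group S R\<^esub> z =
      x \<otimes>\<^bsub>presented_group S R\<^esub> (y \<otimes>\<^bsub>presented_group S R\<^esub> z)"
    by (auto simp: carrier_presented_group mult_presented_group)
next
  fix x
  assume "x \<in> carrier (presented_group S R)"
  then obtain w where w: "w \<in> words S" "x = word_class S R w"
    by (auto simp: carrier_presented_group)
  let ?w = "rev (map (apsnd Not) w)"
  have "?w \<in> words S"
    using w by (fastforce simp: words_def)
  moreover have "word_class S R (?w @ w) = word_class S R []"
    using word_class_eq_iff[of "?w @ w" S R "[]"] word_eq_inverse[OF w(1), of R] w calculation
    by simp
  ultimately show "\<exists>y\<in>carrier (presented_group S R).
      y \<otimes>\<^bsub>presented_group S R\<^esub> x = \<one>\<^bsub>presented_group S R\<^esub>"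
    using w by (auto simp: carrier_presented_group mult_presented_group one_presented_group)
qed (auto simp: carrier_presented_group mult_presented_group one_presented_group)

section \<open>Right-angled Artin groups\<close>

text \<open>
  A finite simplicial graph is an instance of the locale \<^locale>\<open>graph\<close>: finite, loop-free,
  without multiple arcs, and symmetric, so that an edge spanned by \<open>v\<close> and \<open>w\<close> is
  represented by two arcs, one from \<open>v\<close> to \<open>w\<close> and one from \<open>w\<close> to \<open>v\<close>.
\<close>

definition raag :: "('a, 'b) pre_digraph \<Rightarrow> 'a word set monoid" where
  "raag \<Gamma> = presented_group (verts \<Gamma>)
    {([(v, True), (w, True)], [(w, True), (v, True)]) | v w. (v, w) \<in> arcs_ends \<Gamma>}"

lemma group_raag: "group (raag \<Gamma>)"
  unfolding raag_def by (rule group_presented_group)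

section \<open>Pro-\<open>p\<close> completions\<close>

definition p_quotient_kernels :: "nat \<Rightarrow> ('g, 'm) monoid_scheme \<Rightarrow> 'g set set" where
  "p_quotient_kernels p G =
    {N. N \<lhd> G \<and> finite (carrier (G Mod N)) \<and> (\<exists>k. order (G Mod N) = p ^ k)}"

text \<open>
  For normal subgroups \<open>N \<subseteq> M\<close>, the projection \<open>G/N \<rightarrow> G/M\<close> maps the coset \<open>C = N g\<close> to
  the product set \<open>M C = M g\<close>.
\<close>

definition pro_p_carrier :: "nat \<Rightarrow> ('g, 'm) monoid_scheme \<Rightarrow> ('g set \<Rightarrow> 'g set) set" where
  "pro_p_carrier p G =
    {x \<in> (\<Pi>\<^sub>E N\<in>p_quotient_kernels p G. carrier (G Mod N)).
      \<forall>N\<in>p_quotient_kernels p G. \<forall>M\<in>p_quotient_kernels p G. N \<subseteq> M \<longrightarrow> M <#>\<^bsub>G\<^esub> x N = x M}"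

definition pro_p_completion :: "nat \<Rightarrow> ('g, 'm) monoid_scheme \<Rightarrow> ('g set \<Rightarrow> 'g set) monoid" where
  "pro_p_completion p G =
    (product_group (p_quotient_kernels p G) (\<lambda>N. G Mod N))\<lparr>carrier := pro_p_carrier p G\<rparr>"

definition pro_p_topology :: "nat \<Rightarrow> ('g, 'm) monoid_scheme \<Rightarrow> ('g set \<Rightarrow> 'g set) topology" where
  "pro_p_topology p G =
    subtopology
      (product_topology (\<lambda>N. discrete_topology (carrier (G Mod N))) (p_quotient_kernels p G))
      (pro_p_carrier p G)"

lemma topspace_pro_p_topology: "topspace (pro_p_topology p G) = carrier (pro_p_completion p G)"
  by (auto simp: pro_p_topology_def pro_p_completion_def pro_p_carrier_def)

lemma coset_projection:
  assumes "group G" "N \<lhd> G" "M \<lhd> G" "N \<subseteq> M" "g \<in> carrier G"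
  shows "M <#>\<^bsub>G\<^esub> (N #>\<^bsub>G\<^esub> g) = M #>\<^bsub>G\<^esub> g"
proof -
  interpret group G by fact
  have s: "subgroup N G" "subgroup M G"
    using assms normal_imp_subgroup by auto
  have "M <#>\<^bsub>G\<^esub> N = M"
  proof
    show "M <#>\<^bsub>G\<^esub> N \<subseteq> M"
      using mono_set_mult[OF subset_refl[of M] assms(4), of G] subgroup_mult_id[OF s(2)] by simp
    have "m \<in> M <#>\<^bsub>G\<^esub> N" if "m \<in> M" for m
      unfolding set_mult_def
      using that subgroup.one_closed[OF s(1)] subgroup.mem_carrier[OF s(2) that] r_one[of m]
      by force
    then show "M \<subseteq> M <#>\<^bsub>G\<^esub> N" ..
  qed
  then show ?thesis
    using setmult_rcos_assoc[OF subgroup.subset[OF s(2)] subgroup.subset[OF s(1)] assms(5)]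
    by simp
qed

lemma group_pro_p_completion:
  assumes "group G"
  shows "group (pro_p_completion p G)"
proof -
  interpret group G by fact
  let ?K = "p_quotient_kernels p G"
  let ?P = "product_group ?K (\<lambda>N. G Mod N)"
  have nrm: "N \<lhd> G" if "N \<in> ?K" for N
    using that by (auto simp: p_quotient_kernels_def)
  have fg: "group (G Mod N)" if "N \<in> ?K" for N
    using nrm[OF that] by (rule normal.factorgroup_is_group)
  interpret P: group ?P
    by (rule product_group) (rule fg)
  have proj: "(\<lambda>C. M <#>\<^bsub>G\<^esub> C) \<in> hom (G Mod N) (G Mod M)"
    if "N \<in> ?K" "M \<in> ?K" "N \<subseteq> M" for N M
    using that nrm
    by (auto intro!: homI simp: carrier_FactGroup coset_projection assms normal.rcos_sum)
  have "subgroup (pro_p_carrier p G) ?P"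
  proof (rule P.subgroupI)
    show "pro_p_carrier p G \<subseteq> carrier ?P"
      by (auto simp: pro_p_carrier_def)
    have "\<one>\<^bsub>?P\<^esub> \<in> pro_p_carrier p G"
      using P.one_closed hom_one[OF proj fg fg]
      by (auto simp: pro_p_carrier_def)
    then show "pro_p_carrier p G \<noteq> {}" by blast
  next
    fix x assume x: "x \<in> pro_p_carrier p G"
    then have xc: "x \<in> carrier ?P"
      by (auto simp: pro_p_carrier_def)
    have inv_x: "inv\<^bsub>?P\<^esub> x = (\<lambda>N\<in>?K. inv\<^bsub>G Mod N\<^esub> x N)"
      using xc fg by (subst inv_product_group) auto
    have "M <#>\<^bsub>G\<^esub> inv\<^bsub>G Mod N\<^esub> x N = inv\<^bsub>G Mod M\<^esub> x M"
      if "N \<in> ?K" "M \<in> ?K" "N \<subseteq> M" for N M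
    proof -
      interpret h: group_hom "G Mod N" "G Mod M" "\<lambda>C. M <#>\<^bsub>G\<^esub> C"
        using that fg proj by (auto simp: group_hom_def group_hom_axioms_def)
      have "x N \<in> carrier (G Mod N)" "M <#>\<^bsub>G\<^esub> x N = x M"
        using x that unfolding pro_p_carrier_def by blast+
      then show ?thesis
        using h.hom_inv[of "x N"] by metis
    qed
    then show "inv\<^bsub>?P\<^esub> x \<in> pro_p_carrier p G"
      using P.inv_closed[OF xc] unfolding inv_x by (auto simp: pro_p_carrier_def)
  next
    fix x y assume xy: "x \<in> pro_p_carrier p G" "y \<in> pro_p_carrier p G"
    then have xyc: "x \<in> carrier ?P" "y \<in> carrier ?P"
      by (auto simp: pro_p_carrier_def)
    have "M <#>\<^bsub>G\<^esub> (x N <#>\<^bsub>G\<^esub> y N) = x M <#>\<^bsub>G\<^esub> y M"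
      if "N \<in> ?K" "M \<in> ?K" "N \<subseteq> M" for N M
    proof -
      have "x N \<in> carrier (G Mod N)" "M <#>\<^bsub>G\<^esub> x N = x M"
        "y N \<in> carrier (G Mod N)" "M <#>\<^bsub>G\<^esub> y N = y M"
        using xy that unfolding pro_p_carrier_def by blast+
      then show ?thesis
        using hom_mult[OF proj[OF that], of "x N" "y N"] by simp
    qed
    then show "x \<otimes>\<^bsub>?P\<^esub> y \<in> pro_p_carrier p G"
      using P.m_closed[OF xyc] by (auto simp: pro_p_carrier_def)
  qed
  then show ?thesis
    unfolding pro_p_completion_def by (rule P.subgroup_imp_group)
qed

definition topological_groups_isomorphic ::
  "('g, 'm) monoid_scheme \<Rightarrow> 'g topology \<Rightarrow> ('h, 'n) monoid_scheme \<Rightarrow> 'h topology \<Rightarrow> bool" where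
  "topological_groups_isomorphic G X H Y \<longleftrightarrow> (\<exists>f. f \<in> iso G H \<and> homeomorphic_map X Y f)"

end

theory Submission
  imports Defs "HOL-Number_Theory.Cong"
begin

text \<open>
  Continuous homomorphisms from the completion to \<open>\<int>/p\<close> form the space \<open>F\<^sub>p\<^sup>V\<close>, and two of them,
  \<open>a\<close> and \<open>b\<close>, have vanishing cup product iff \<open>(a, b)\<close> lifts to the Heisenberg group mod \<open>p\<close>, that is,
  iff \<open>a\<^sub>v b\<^sub>w = a\<^sub>w b\<^sub>v\<close> for every edge \<open>vw\<close>. A topological isomorphism therefore yields a linear
  isomorphism \<open>\<phi>\<close> of \<open>F\<^sub>p\<^sup>V\<close> with \<open>F\<^sub>p\<^sup>V'\<close> preserving this relation \<open>\<bottom>\<close>. For \<open>v\<close> in the support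
  of \<open>a\<close>, the space \<open>a\<^sup>\<bottom>\<close> is at most as large as \<open>e\<^sub>v\<^sup>\<bottom>\<close>, which has dimension \<open>|V| - deg v\<close>,
  and equality forces every \<open>u\<close> in the support to satisfy \<open>N(u) \<subseteq> N(v) \<union> {v}\<close>. Hence \<open>\<phi>\<close> is triangular
  for the filtration by degree. Hall's theorem gives a bijection \<open>\<sigma>\<close> with \<open>\<sigma> v\<close> in the support of
  \<open>\<phi>(e\<^sub>v)\<close>; it preserves degrees because degrees can only drop in both directions, and it maps
  non-edges to non-edges, so that it is an isomorphism.
\<close>

section \<open>Hall's marriage theorem\<close>

theorem hall_marriage:
  assumes "finite A" "\<And>a. a \<in> A \<Longrightarrow> finite (N a)"
    and "\<And>S. S \<subseteq> A \<Longrightarrow> card S \<le> card (\<Union>(N ` S))"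
  shows "\<exists>f. inj_on f A \<and> (\<forall>a\<in>A. f a \<in> N a)"
  using assms
proof (induction "card A" arbitrary: A N rule: less_induct)
  case less
  note fin = less.prems(1,2) and hall = less.prems(3)
  have finU: "finite (\<Union>(N ` S))" if "S \<subseteq> A" for S
    using that fin by (meson finite_UN finite_subset subset_eq)
  show ?case
  \<comment> \<open>Split on whether some proper nonempty subset \<open>S\<close> is tight, that is,
    has exactly \<open>card S\<close> neighbours in all.\<close>
  proof (cases "\<exists>S. S \<subset> A \<and> S \<noteq> {} \<and> card (\<Union>(N ` S)) = card S")
    case True
    then obtain S where S: "S \<subset> A" "S \<noteq> {}" "card (\<Union>(N ` S)) = card S" by blast
    have finS: "finite S" using S fin finite_subset by blast
    have "card S < card A" using S fin psubset_card_mono by blast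
    then obtain f where f: "inj_on f S" "\<And>a. a \<in> S \<Longrightarrow> f a \<in> N a"
      using less.hyps[of S N] S finS fin hall by (metis psubset_imp_subset subset_eq)
    \<comment> \<open>The neighbours of \<open>S\<close> are reserved for \<open>S\<close>.
      Tightness turns the Hall condition for \<open>T \<union> S\<close> into the one for
      \<open>T\<close> with the remaining neighbours.\<close>
    let ?N = "\<lambda>a. N a - \<Union>(N ` S)"
    have lt: "card (A - S) < card A" using S fin by (intro psubset_card_mono) auto
    have hall': "card T \<le> card (\<Union>(?N ` T))" if T: "T \<subseteq> A - S" for T
    proof -
      have finT: "finite T" using T fin finite_subset by blast
      have "card T + card S = card (T \<union> S)"
        using T finT finS by (subst card_Un_disjoint) auto
      also have "\<dots> \<le> card (\<Union>(N ` (T \<union> S)))"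
        using S T by (intro hall) auto
      also have "\<Union>(N ` (T \<union> S)) = \<Union>(?N ` T) \<union> \<Union>(N ` S)" by auto
      also have "card \<dots> \<le> card (\<Union>(?N ` T)) + card S"
        using card_Un_le[of "\<Union>(?N ` T)" "\<Union>(N ` S)"] S(3) by simp
      finally show ?thesis by simp
    qed
    obtain g where g: "inj_on g (A - S)" "\<And>a. a \<in> A - S \<Longrightarrow> g a \<in> ?N a"
      using less.hyps[OF lt _ _ hall'] fin by (metis Diff_iff finite_Diff)
    let ?h = "\<lambda>a. if a \<in> S then f a else g a"
    have "inj_on ?h A"
    proof (rule inj_onI)
      fix x y assume "x \<in> A" "y \<in> A" "?h x = ?h y"
      then show "x = y"
        using f g by (cases "x \<in> S"; cases "y \<in> S") (auto dest: inj_onD, (metis DiffI UN_I DiffD2)+)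
    qed
    moreover have "\<forall>a\<in>A. ?h a \<in> N a" using f g by auto
    ultimately show ?thesis by blast
  next
    case False
    show ?thesis
    proof (cases "A = {}")
      case False': False
      then obtain a where a: "a \<in> A" by blast
      have "N a \<noteq> {}" using hall[of "{a}"] a by auto
      then obtain b where b: "b \<in> N a" by blast
      \<comment> \<open>Without tight subsets, every nonempty proper subset has a spare neighbour,
        so reserving \<open>b\<close> for \<open>a\<close> keeps the Hall condition on the
        rest.\<close>
      let ?N = "\<lambda>x. N x - {b}"
      have lt: "card (A - {a}) < card A" using a fin by (metis card_Diff1_less)
      have hall': "card T \<le> card (\<Union>(?N ` T))" if T: "T \<subseteq> A - {a}" for T
      proof (cases "T = {}")
        case False'': False
        have "T \<subset> A" using T a by blast
        then have "card T < card (\<Union>(N ` T))"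
          using False False'' hall[of T] by (metis le_neq_implies_less psubset_imp_subset)
        moreover have eq: "\<Union>(?N ` T) = \<Union>(N ` T) - {b}" by auto
        moreover have "card (\<Union>(N ` T)) - 1 \<le> card (\<Union>(N ` T) - {b})"
          using card_Diff1_le diff_card_le_card_Diff[of "{b}" "\<Union>(N ` T)"] by simp
        ultimately show ?thesis unfolding eq by linarith
      qed simp
      obtain g where g: "inj_on g (A - {a})" "\<And>x. x \<in> A - {a} \<Longrightarrow> g x \<in> ?N x"
        using less.hyps[OF lt _ _ hall'] fin by (metis Diff_iff finite_Diff)
      let ?h = "g(a := b)"
      have "inj_on ?h (insert a (A - {a}))"
        unfolding inj_on_insert using g by (auto simp: inj_on_def)
      then have "inj_on ?h A" using a by (simp add: insert_absorb)
      moreover have "\<forall>x\<in>A. ?h x \<in> N x" using g b by auto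
      ultimately show ?thesis by blast
    qed simp
  qed
qed

section \<open>Graphs and vectors mod \<open>p\<close>\<close>

text \<open>Integer functions stand for vectors over F_p, so equations are congruences. For an edge
  the condition is the vanishing of a 2 by 2 determinant, the coordinate at that edge of the cup
  product of \<open>a\<close> and \<open>b\<close>.\<close>

definition perp :: "('a \<times> 'a) set \<Rightarrow> nat \<Rightarrow> ('a \<Rightarrow> int) \<Rightarrow> ('a \<Rightarrow> int) \<Rightarrow> bool" where
  "perp E p a b \<longleftrightarrow> (\<forall>(v, w)\<in>E. [a v * b w = a w * b v] (mod int p))"

definition basis_vec :: "'a \<Rightarrow> 'a \<Rightarrow> int" where
  "basis_vec v = (\<lambda>u. if u = v then 1 else 0)"

section \<open>Orthogonal spaces and vertex degrees\<close>

locale graph_mod =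
  fixes p :: nat and V :: "'a set" and E :: "('a \<times> 'a) set"
  assumes prime: "prime p" and fin_V: "finite V" and E_sub: "E \<subseteq> V \<times> V"
    and E_sym: "(v, w) \<in> E \<Longrightarrow> (w, v) \<in> E" and E_irrefl: "(v, v) \<notin> E"
begin

abbreviation nbrs :: "'a \<Rightarrow> 'a set" where "nbrs v \<equiv> E `` {v}"

text \<open>Exactly one representative for each vector over F_p, so that spaces can be compared by
  cardinality instead of dimension.\<close>

abbreviation vecs :: "('a \<Rightarrow> int) set" where "vecs \<equiv> V \<rightarrow>\<^sub>E {0..<int p}"

definition perps :: "('a \<Rightarrow> int) \<Rightarrow> ('a \<Rightarrow> int) set" where
  "perps a = {b \<in> vecs. perp E p a b}"

lemma nbrs_sub: "nbrs v \<subseteq> V - {v}"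
  using E_sub E_irrefl by auto

lemma fin_nbrs [simp]: "finite (nbrs v)"
  using nbrs_sub fin_V by (meson finite_Diff finite_subset)

lemma p_gt: "int p > 1"
  using prime prime_gt_1_nat by simp

lemma prime_p: "Factorial_Ring.prime (int p)"
  using prime by simp

lemma fin_vecs: "finite vecs"
  using fin_V by (intro finite_PiE) auto

lemma fin_perps [simp]: "finite (perps a)"
  using fin_vecs by (auto simp: perps_def)

lemma dvd_residue: "x \<in> {0..<int p} \<Longrightarrow> int p dvd x \<longleftrightarrow> x = 0"
  using p_gt using zdvd_imp_le[of "int p" x] by fastforce

lemma residue_eqI:
  "x \<in> {0..<int p} \<Longrightarrow> y \<in> {0..<int p} \<Longrightarrow> [x = y] (mod int p) \<Longrightarrow> x = y"
  by (simp add: cong_def)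

text \<open>Only the edges at \<open>v\<close> impose a condition, and each kills one coordinate.
  The product form is ready for \<open>card_PiE\<close>.\<close>

lemma perps_basis_vec:
  assumes "v \<in> V"
  shows "perps (basis_vec v) = (\<Pi>\<^sub>E w\<in>V. if w \<in> nbrs v then {0} else {0..<int p})"
    (is "_ = ?R")
proof -
  have "perp E p (basis_vec v) b \<longleftrightarrow> (\<forall>w\<in>nbrs v. b w = 0)" if b: "b \<in> vecs" for b
  proof
    assume h: "perp E p (basis_vec v) b"
    show "\<forall>w\<in>nbrs v. b w = 0"
    proof
      fix w assume w: "w \<in> nbrs v"
      then have "[b w = 0] (mod int p)"
        using h E_irrefl[of v] by (fastforce simp: perp_def basis_vec_def split: if_splits)
      moreover have "b w \<in> {0..<int p}" using b w nbrs_sub by blast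
      ultimately show "b w = 0" using dvd_residue by (simp add: cong_0_iff)
    qed
  next
    assume h: "\<forall>w\<in>nbrs v. b w = 0"
    show "perp E p (basis_vec v) b"
      unfolding perp_def
    proof clarify
      fix x y assume "(x, y) \<in> E"
      then show "[basis_vec v x * b y = basis_vec v y * b x] (mod int p)"
        using h E_sym[of x y] by (auto simp: basis_vec_def)
    qed
  qed
  then have "perps (basis_vec v) = {b \<in> vecs. \<forall>w\<in>nbrs v. b w = 0}"
    by (auto simp: perps_def)
  also have "\<dots> = ?R"
  proof (intro equalityI subsetI)
    fix b assume "b \<in> {b \<in> vecs. \<forall>w\<in>nbrs v. b w = 0}"
    then show "b \<in> ?R" by (auto simp: PiE_iff)
  next
    fix b assume b: "b \<in> ?R"
    have "b w = 0" if "w \<in> nbrs v" for w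
    proof -
      have "w \<in> V" using that nbrs_sub by blast
      then show ?thesis using PiE_mem[OF b, of w] that by simp
    qed
    moreover have "b w \<in> {0..<int p}" if "w \<in> V" for w
      using PiE_mem[OF b that] p_gt by (simp split: if_splits)
    moreover have "b \<in> extensional V" using b by (simp only: PiE_iff)
    ultimately show "b \<in> {b \<in> vecs. \<forall>w\<in>nbrs v. b w = 0}" by (simp add: PiE_iff)
  qed
  finally show ?thesis .
qed

lemma card_perps_basis_vec:
  assumes "v \<in> V"
  shows "card (perps (basis_vec v)) = p ^ (card V - card (nbrs v))"
proof -
  have "card (perps (basis_vec v)) = (\<Prod>w\<in>V. if w \<in> nbrs v then 1 else p)"
    unfolding perps_basis_vec[OF assms] using fin_V
    by (subst card_PiE) (auto intro!: prod.cong)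
  also have "\<dots> = (\<Prod>w\<in>V - nbrs v. p)"
    using fin_V by (simp add: prod.If_cases Diff_eq Collect_neg_eq del: Image_singleton_iff)
  also have "\<dots> = p ^ (card V - card (nbrs v))"
    using nbrs_sub[of v] by (simp add: card_Diff_subset subset_Diff_insert)
  finally show ?thesis .
qed

text \<open>The linear projection that forgets the coordinates at the neighbours of
  \<open>v\<close>. It compares the orthogonal space of a vector with that of
  \<open>basis_vec v\<close>.\<close>

definition off_nbrs :: "'a \<Rightarrow> ('a \<Rightarrow> int) \<Rightarrow> 'a \<Rightarrow> int" where
  "off_nbrs v b = (\<lambda>u\<in>V. if u \<in> nbrs v then 0 else b u)"

lemma off_nbrs_in: "v \<in> V \<Longrightarrow> b \<in> perps a \<Longrightarrow> off_nbrs v b \<in> perps (basis_vec v)"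
  using p_gt by (subst perps_basis_vec) (auto simp: off_nbrs_def perps_def PiE_iff)

text \<open>Once \<open>b v\<close> vanishes, the unit \<open>a v\<close> can be cancelled mod
  \<open>p\<close>. Zeros of \<open>b\<close> thus spread along edges that leave the support of
  \<open>a\<close>.\<close>

lemma perpD_dvd:
  assumes "perp E p a b" "(v, w) \<in> E" "\<not> int p dvd a v" "[b v = 0] (mod int p)"
  shows "[b w = 0] (mod int p)"
proof -
  have "[a v * b w = a w * b v] (mod int p)" using assms by (auto simp: perp_def)
  also have "[a w * b v = a w * 0] (mod int p)" using assms(4) by (rule cong_scalar_left)
  finally show ?thesis
    using prime_p assms(3) prime_dvd_mult_iff[of "int p"] by (simp add: cong_0_iff)
qed

text \<open>The difference of two vectors with the same projection is again orthogonal to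
  \<open>a\<close> and vanishes at \<open>v\<close>, which is not its own neighbour;
  \<open>perpD_dvd\<close> then makes it vanish at all neighbours of \<open>v\<close>.\<close>

lemma inj_off_nbrs:
  assumes v: "v \<in> V" "\<not> int p dvd a v"
  shows "inj_on (off_nbrs v) (perps a)"
proof (rule inj_onI)
  fix b c assume b: "b \<in> perps a" and c: "c \<in> perps a" and eq: "off_nbrs v b = off_nbrs v c"
  have eq': "b u = c u" if "u \<in> V - nbrs v" for u
    using that fun_cong[OF eq, of u] by (auto simp: off_nbrs_def)
  have "perp E p a b" "perp E p a c" using b c by (auto simp: perps_def)
  then have d: "perp E p a (\<lambda>u. b u - c u)"
    unfolding perp_def by (auto simp: right_diff_distrib intro: cong_diff)
  have "b u = c u" if u: "u \<in> V" for u
  proof (cases "u \<in> nbrs v")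
    case True
    have "b v = c v" using eq'[of v] v nbrs_sub[of v] by blast
    then have "[b u = c u] (mod int p)"
      using perpD_dvd[OF d, of v u] True v by (simp add: cong_diff_iff_cong_0)
    moreover have "b u \<in> {0..<int p}" "c u \<in> {0..<int p}" using b c u by (auto simp: perps_def)
    ultimately show ?thesis by (auto simp: cong_def)
  qed (use eq' u in auto)
  then show "b = c"
    using b c by (auto simp: perps_def intro: PiE_ext)
qed

lemma card_perps_le:
  assumes "v \<in> V" "\<not> int p dvd a v"
  shows "card (perps a) \<le> card (perps (basis_vec v))"
  using card_inj_on_le[OF inj_off_nbrs[of v a] _ fin_perps] off_nbrs_in[OF assms(1)] assms by blast

text \<open>Equality makes the projection \<open>off_nbrs v\<close> bijective. If \<open>x\<close>
  violated the inclusion, \<open>basis_vec x\<close> would lift to some \<open>b\<close> orthogonal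
  to \<open>a\<close>. It vanishes at \<open>v\<close> and at \<open>u\<close>, so the edge
  \<open>ux\<close> forces it to vanish at \<open>x\<close>, where its value is 1.\<close>

lemma dominated_if_card_perps_eq:
  assumes v: "v \<in> V" "\<not> int p dvd a v" and eq: "card (perps a) = card (perps (basis_vec v))"
    and u: "u \<in> V" "\<not> int p dvd a u"
  shows "nbrs u \<subseteq> insert v (nbrs v)"
proof
  fix x assume x: "x \<in> nbrs u"
  show "x \<in> insert v (nbrs v)"
  proof (rule ccontr)
    assume nx: "x \<notin> insert v (nbrs v)"
    have "off_nbrs v ` perps a \<subseteq> perps (basis_vec v)"
      using off_nbrs_in[OF v(1)] by blast
    moreover have "card (off_nbrs v ` perps a) = card (perps (basis_vec v))"
      using inj_off_nbrs[of v a] v eq by (simp add: card_image)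
    ultimately have surj: "off_nbrs v ` perps a = perps (basis_vec v)"
      by (intro card_subset_eq) auto
    have "x \<in> V" using x nbrs_sub by blast
    then have "restrict (basis_vec x) V \<in> perps (basis_vec v)"
      using nx p_gt unfolding perps_basis_vec[OF v(1)] by (auto simp: basis_vec_def PiE_iff)
    then obtain b where b: "b \<in> perps a" "restrict (basis_vec x) V = off_nbrs v b"
      using surj by blast
    then have b': "b y = basis_vec x y" if "y \<in> V - nbrs v" for y
    proof -
      have "restrict (basis_vec x) V y = off_nbrs v b y" using b(2) by simp
      then show ?thesis using that by (simp add: off_nbrs_def)
    qed
    have perp: "perp E p a b" using b by (simp add: perps_def)
    have "v \<in> V - nbrs v" using v nbrs_sub by blast
    then have bv: "b v = 0" using b'[of v] nx by (auto simp: basis_vec_def)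
    have "x \<noteq> u" using x E_irrefl by auto
    \<comment> \<open>At a neighbour of \<open>v\<close> this comes from the edge to
      \<open>v\<close>; elsewhere \<open>b\<close> agrees with \<open>basis_vec x\<close>, and
      \<open>x \<noteq> u\<close>.\<close>
    then have "[b u = 0] (mod int p)"
      using perpD_dvd[OF perp, of v u] v bv b'[of u] u by (cases "u \<in> nbrs v") (auto simp: basis_vec_def)
    then have "[b x = 0] (mod int p)"
      using perpD_dvd[OF perp, of u x] u x by auto
    moreover have "b x = 1" using b'[of x] nx \<open>x \<in> V\<close> by (auto simp: basis_vec_def)
    ultimately show False using p_gt by (simp add: cong_0_iff)
  qed
qed

lemma perps_cong:
  assumes "\<And>v. v \<in> V \<Longrightarrow> [a v = a' v] (mod int p)"
  shows "perps a = perps a'"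
proof -
  have "[a v * b w = a' v * b w] (mod int p) \<and> [a w * b v = a' w * b v] (mod int p)"
    if "(v, w) \<in> E" for v w b
    using that E_sub assms by (auto intro!: cong_scalar_right)
  then have "perp E p a b = perp E p a' b" for b
    unfolding perp_def cong_def by (metis (no_types, lifting) case_prodD case_prodI2)
  then show ?thesis by (simp add: perps_def)
qed

lemma card_E: "card E = (\<Sum>v\<in>V. card (nbrs v))"
proof -
  have "E = Sigma V nbrs" using E_sub by auto
  then have "card E = card (Sigma V nbrs)" by simp
  also have "\<dots> = (\<Sum>v\<in>V. card (nbrs v))"
    using fin_V by (simp add: card_SigmaI)
  finally show ?thesis .
qed

lemma card_nbrs_le: "card (nbrs v) \<le> card V"
  using nbrs_sub fin_V by (meson Diff_subset card_mono subset_trans)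

lemma perp_basis_vec_if_not_edge:
  assumes "(v, w) \<notin> E"
  shows "perp E p (basis_vec v) (basis_vec w)"
  using assms E_sym by (auto simp: perp_def basis_vec_def)

end

section \<open>Linear isomorphisms that preserve orthogonality\<close>

text \<open>\<open>\<phi>\<close> and \<open>\<psi>\<close> are inverse linear maps over F_p,
  written on integer functions. One law covers sums and scalar multiples; the congruence assumptions
  make the maps well defined mod \<open>p\<close> and independent of values outside the vertex
  sets.\<close>

locale perp_equiv = G: graph_mod p V E + H: graph_mod p V' E'
  for p :: nat and V :: "'a set" and E and V' :: "'c set" and E' +
  fixes \<phi> :: "('a \<Rightarrow> int) \<Rightarrow> 'c \<Rightarrow> int" and \<psi> :: "('c \<Rightarrow> int) \<Rightarrow> 'a \<Rightarrow> int"
  assumes \<phi>_lin: "u \<in> V' \<Longrightarrow> [\<phi> (\<lambda>v. a v + c * b v) u = \<phi> a u + c * \<phi> b u] (mod int p)"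
    and \<psi>_lin: "v \<in> V \<Longrightarrow> [\<psi> (\<lambda>v. a' v + c * b' v) v = \<psi> a' v + c * \<psi> b' v] (mod int p)"
    and \<phi>_cong: "(\<And>v. v \<in> V \<Longrightarrow> [a v = b v] (mod int p)) \<Longrightarrow> u \<in> V' \<Longrightarrow> [\<phi> a u = \<phi> b u] (mod int p)"
    and \<psi>_cong: "(\<And>u. u \<in> V' \<Longrightarrow> [a' u = b' u] (mod int p)) \<Longrightarrow> v \<in> V \<Longrightarrow> [\<psi> a' v = \<psi> b' v] (mod int p)"
    and \<psi>_\<phi>: "v \<in> V \<Longrightarrow> [\<psi> (\<phi> a) v = a v] (mod int p)"
    and \<phi>_\<psi>: "u \<in> V' \<Longrightarrow> [\<phi> (\<psi> a') u = a' u] (mod int p)"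
    and \<phi>_perp: "perp E p a b \<Longrightarrow> perp E' p (\<phi> a) (\<phi> b)"
    and \<psi>_perp: "perp E' p a' b' \<Longrightarrow> perp E p (\<psi> a') (\<psi> b')"
begin

text \<open>The assumptions come in symmetric pairs, so each inequality proved for
  \<open>\<phi>\<close> also holds for \<open>\<psi>\<close>, and the two combine to
  equalities.\<close>

lemma perp_equiv_sym: "perp_equiv p V' E' V E \<psi> \<phi>"
  by unfold_locales (fact \<phi>_lin \<psi>_lin \<phi>_cong \<psi>_cong \<phi>_\<psi> \<psi>_\<phi> \<phi>_perp \<psi>_perp)+

lemma \<phi>_zero: "u \<in> V' \<Longrightarrow> [\<phi> (\<lambda>_. 0) u = 0] (mod int p)"
  using \<phi>_lin[of u "\<lambda>_. 0" 1 "\<lambda>_. 0"] by (simp add: cong_iff_dvd_diff)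

lemma \<phi>_scale:
  assumes "u \<in> V'"
  shows "[\<phi> (\<lambda>v. c * a v) u = c * \<phi> a u] (mod int p)"
proof -
  have "[\<phi> (\<lambda>v. c * a v) u = \<phi> (\<lambda>_. 0) u + c * \<phi> a u] (mod int p)"
    using \<phi>_lin[OF assms, of "\<lambda>_. 0"] by simp
  also have "[\<phi> (\<lambda>_. 0) u + c * \<phi> a u = 0 + c * \<phi> a u] (mod int p)"
    using \<phi>_zero[OF assms] by (rule cong_add) simp
  finally show ?thesis by simp
qed

text \<open>Takes the place of expanding \<open>a\<close> in the basis: the coordinates in
  \<open>S\<close> are removed one basis vector at a time until \<open>a\<close> is zero mod
  \<open>p\<close>.\<close>

lemma \<phi>_vanish:
  assumes "finite S" "\<And>v. v \<in> V - S \<Longrightarrow> [a v = 0] (mod int p)"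
    and "\<And>v. v \<in> S \<Longrightarrow> [\<phi> (basis_vec v) u = 0] (mod int p)" and u: "u \<in> V'"
  shows "[\<phi> a u = 0] (mod int p)"
  using assms(1-3)
proof (induction S arbitrary: a rule: finite_induct)
  case empty
  then have "[\<phi> a u = \<phi> (\<lambda>_. 0) u] (mod int p)" using u by (intro \<phi>_cong) auto
  then show ?case using \<phi>_zero[OF u] cong_trans by blast
next
  case (insert s S)
  let ?a = "a(s := 0)"
  have "a = (\<lambda>v. ?a v + a s * basis_vec s v)" by (auto simp: basis_vec_def)
  then have "[\<phi> a u = \<phi> ?a u + a s * \<phi> (basis_vec s) u] (mod int p)"
    using \<phi>_lin[OF u, of ?a "a s" "basis_vec s"] by simp
  also have "[\<phi> ?a u + a s * \<phi> (basis_vec s) u = 0 + a s * 0] (mod int p)"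
  proof (rule cong_add)
    show "[\<phi> ?a u = 0] (mod int p)"
      by (rule insert.IH) (use insert.prems in auto)
    show "[a s * \<phi> (basis_vec s) u = a s * 0] (mod int p)"
      using insert.prems by (intro cong_scalar_left) simp
  qed
  finally show ?case by simp
qed

lemma \<phi>_inj:
  assumes "\<And>u. u \<in> V' \<Longrightarrow> [\<phi> a u = \<phi> b u] (mod int p)" and v: "v \<in> V"
  shows "[a v = b v] (mod int p)"
proof -
  have "[\<psi> (\<phi> a) v = \<psi> (\<phi> b) v] (mod int p)" using assms by (rule \<psi>_cong)
  then show ?thesis
    using \<psi>_\<phi>[OF v, of a] \<psi>_\<phi>[OF v, of b] by (simp add: cong_def)
qed

lemma card_perps_\<phi>_ge: "card (G.perps a) \<le> card (H.perps (\<phi> a))"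
proof (rule card_inj_on_le)
  let ?F = "\<lambda>b. \<lambda>u\<in>V'. \<phi> b u mod int p"
  show "?F ` G.perps a \<subseteq> H.perps (\<phi> a)"
  proof clarify
    fix b assume b: "b \<in> G.perps a"
    have "perp E' p (\<phi> a) (\<phi> b)" using b \<phi>_perp by (auto simp: G.perps_def)
    then have "perp E' p (\<phi> a) (?F b)"
      using H.E_sub by (auto simp: perp_def cong_def mod_mult_right_eq)
    then show "?F b \<in> H.perps (\<phi> a)"
      using H.p_gt by (auto simp: H.perps_def)
  qed
  show "inj_on ?F (G.perps a)"
  proof (rule inj_onI)
    fix b c assume b: "b \<in> G.perps a" and c: "c \<in> G.perps a" and eq: "?F b = ?F c"
    have "[\<phi> b u = \<phi> c u] (mod int p)" if "u \<in> V'" for u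
      using fun_cong[OF eq, of u] that by (simp add: cong_def)
    then have "[b v = c v] (mod int p)" if "v \<in> V" for v
      using that by (rule \<phi>_inj)
    then have "b v = c v" if "v \<in> V" for v
      using that b c by (fastforce simp: G.perps_def cong_def PiE_iff)
    then show "b = c" using b c by (auto simp: G.perps_def intro: PiE_ext)
  qed
qed simp

text \<open>The reverse inequality is the same lemma for \<open>\<psi>\<close>, applied to
  \<open>\<phi> a\<close>. The size of the orthogonal space is the invariant from which degrees are
  recovered.\<close>

lemma card_perps_\<phi>: "card (H.perps (\<phi> a)) = card (G.perps a)"
proof -
  interpret S: perp_equiv p V' E' V E \<psi> \<phi> by (rule perp_equiv_sym)
  have "card (H.perps (\<phi> a)) \<le> card (G.perps (\<psi> (\<phi> a)))" by (rule S.card_perps_\<phi>_ge)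
  also have "G.perps (\<psi> (\<phi> a)) = G.perps a" by (intro G.perps_cong \<psi>_\<phi>)
  finally show ?thesis using card_perps_\<phi>_ge[of a] by simp
qed

text \<open>The rows with a nonzero entry in column \<open>v\<close> of the matrix of
  \<open>\<phi>\<close> over F_p.\<close>

definition supp :: "'a \<Rightarrow> 'c set" where
  "supp v = {u \<in> V'. \<not> int p dvd \<phi> (basis_vec v) u}"

text \<open>Hall's condition by counting: \<open>\<phi>\<close> is injective on the span of the
  basis vectors in \<open>S\<close>, and the images live on the coordinates in the union of the
  supports.\<close>

lemma hall_supp:
  assumes S: "S \<subseteq> V"
  shows "card S \<le> card (\<Union>(supp ` S))"
proof -
  let ?U = "\<Union>(supp ` S)"
  let ?ext = "\<lambda>b v. if v \<in> S then b v else 0"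
  let ?F = "\<lambda>b. \<lambda>u\<in>?U. \<phi> (?ext b) u mod int p"
  have fin: "finite S" "finite ?U"
    using S G.fin_V H.fin_V by (auto simp: supp_def intro: finite_subset)
  have "card (S \<rightarrow>\<^sub>E {0..<int p}) \<le> card (?U \<rightarrow>\<^sub>E {0..<int p})"
  proof (rule card_inj_on_le)
    show "?F ` (S \<rightarrow>\<^sub>E {0..<int p}) \<subseteq> ?U \<rightarrow>\<^sub>E {0..<int p}"
      using H.p_gt by auto
    show "finite (?U \<rightarrow>\<^sub>E {0..<int p})" using fin by (intro finite_PiE) auto
    show "inj_on ?F (S \<rightarrow>\<^sub>E {0..<int p})"
    proof (rule inj_onI)
      fix b c assume b: "b \<in> S \<rightarrow>\<^sub>E {0..<int p}" and c: "c \<in> S \<rightarrow>\<^sub>E {0..<int p}" and eq: "?F b = ?F c"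
      have "[\<phi> (?ext b) u = \<phi> (?ext c) u] (mod int p)" if u: "u \<in> V'" for u
      proof (cases "u \<in> ?U")
        case True
        then show ?thesis using fun_cong[OF eq, of u] by (simp add: cong_def)
      next
        case False
        then have nsupp: "[\<phi> (basis_vec v) u = 0] (mod int p)" if "v \<in> S" for v
          using u that by (auto simp: supp_def cong_0_iff)
        have "[\<phi> (?ext d) u = 0] (mod int p)" for d
          using fin(1) _ nsupp u by (rule \<phi>_vanish) simp
        then show ?thesis by (simp add: cong_def)
      qed
      then have ext_eq: "[?ext b v = ?ext c v] (mod int p)" if "v \<in> V" for v
        using that by (rule \<phi>_inj)
      have "b v = c v" if "v \<in> S" for v
      proof (rule G.residue_eqI)
        have "v \<in> V" using S that by blast
        then show "[b v = c v] (mod int p)"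
          using ext_eq[of v] that by simp
      qed (use that b c in \<open>auto simp: PiE_iff\<close>)
      then show "b = c" using b c by (auto intro: PiE_ext)
    qed
  qed
  then have "p ^ card S \<le> p ^ card ?U"
    using fin by (simp add: card_PiE)
  then show ?thesis
    using G.p_gt by (simp add: power_increasing_iff)
qed

lemma card_V_le: "card V \<le> card V'"
proof -
  have "card V \<le> card (\<Union>(supp ` V))" by (rule hall_supp) simp
  also have "\<dots> \<le> card V'" using H.fin_V by (intro card_mono) (auto simp: supp_def)
  finally show ?thesis .
qed

lemma card_V: "card V' = card V"
proof -
  interpret S: perp_equiv p V' E' V E \<psi> \<phi> by (rule perp_equiv_sym)
  show ?thesis using card_V_le S.card_V_le by simp
qed

text \<open>The orthogonal space of \<open>\<phi> (basis_vec v)\<close> is as large as that of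
  \<open>basis_vec v\<close> and at most as large as that of \<open>basis_vec u\<close>; a larger
  space means a smaller degree. Equal degrees are the equality case, where domination
  applies.\<close>

lemma supp_degree:
  assumes "v \<in> V" "u \<in> supp v"
  shows "card (H.nbrs u) \<le> card (G.nbrs v)"
    and "card (H.nbrs u) = card (G.nbrs v) \<Longrightarrow> u' \<in> supp v \<Longrightarrow> H.nbrs u' \<subseteq> insert u (H.nbrs u)"
proof -
  have u: "u \<in> V'" "\<not> int p dvd \<phi> (basis_vec v) u" using assms by (auto simp: supp_def)
  have eq: "card (H.perps (\<phi> (basis_vec v))) = p ^ (card V - card (G.nbrs v))"
    using card_perps_\<phi> G.card_perps_basis_vec[OF assms(1)] by simp
  have eq': "card (H.perps (basis_vec u)) = p ^ (card V - card (H.nbrs u))"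
    using H.card_perps_basis_vec[OF u(1)] card_V by simp
  have "p ^ (card V - card (G.nbrs v)) \<le> p ^ (card V - card (H.nbrs u))"
    using H.card_perps_le[OF u(1), of "\<phi> (basis_vec v)"] u(2) eq eq' by simp
  then have "card V - card (G.nbrs v) \<le> card V - card (H.nbrs u)"
    using G.p_gt by (simp add: power_increasing_iff)
  \<comment> \<open>Subtraction of naturals truncates, so \<open>card_nbrs_le\<close> is needed to
    get back to the degrees.\<close>
  then show "card (H.nbrs u) \<le> card (G.nbrs v)"
    using G.card_nbrs_le[of v] H.card_nbrs_le[of u] card_V by linarith
  assume "card (H.nbrs u) = card (G.nbrs v)" "u' \<in> supp v"
  then show "H.nbrs u' \<subseteq> insert u (H.nbrs u)"
    using u eq eq' by (intro H.dominated_if_card_perps_eq[of u "\<phi> (basis_vec v)"]) (auto simp: supp_def)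
qed

text \<open>
  If \<open>v\<close> and \<open>w\<close> were not adjacent, then \<open>\<phi>(e\<^sub>v)\<close> and \<open>\<phi>(e\<^sub>w)\<close> would be proportional on the vertices of
  degree \<open>d = deg w\<close> (their supports there lie in one clique of twins), so a combination \<open>c\<close> of
  \<open>e\<^sub>v\<close> and \<open>e\<^sub>w\<close> would have its image, and hence itself, supported in degrees below \<open>d\<close>.
\<close>

lemma edge_if_supp_edge:
  assumes v: "v \<in> V" "v' \<in> supp v" "card (H.nbrs v') = card (G.nbrs v)"
    and w: "w \<in> V" "w' \<in> supp w" "card (H.nbrs w') = card (G.nbrs w)"
    and "v \<noteq> w" and edge: "(v', w') \<in> E'" and le: "card (G.nbrs v) \<le> card (G.nbrs w)"
  shows "(v, w) \<in> E"
proof (rule ccontr)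
  assume "(v, w) \<notin> E"
  interpret S: perp_equiv p V' E' V E \<psi> \<phi> by (rule perp_equiv_sym)
  define a where "a = \<phi> (basis_vec v)"
  define b where "b = \<phi> (basis_vec w)"
  define d where "d = card (G.nbrs w)"
  have perp: "perp E' p a b"
    unfolding a_def b_def using \<open>(v, w) \<notin> E\<close> by (intro \<phi>_perp G.perp_basis_vec_if_not_edge)
  have nz: "\<not> int p dvd a v'" "\<not> int p dvd b w'"
    using v w by (auto simp: supp_def a_def b_def)
  have "[a v' * b w' = a w' * b v'] (mod int p)"
    using perp edge by (auto simp: perp_def)
  \<comment> \<open>The left side is a unit mod \<open>p\<close>, so both factors on the right are
    units: \<open>v'\<close> and \<open>w'\<close> lie in both supports.\<close>
  then have nz': "\<not> int p dvd a w'" "\<not> int p dvd b v'"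
    using nz G.prime_p by (metis cong_dvd_iff prime_dvd_mult_iff)+
  have V': "v' \<in> V'" "w' \<in> V'" using v w by (auto simp: supp_def)
  then have supp': "w' \<in> supp v" "v' \<in> supp w" using nz' by (auto simp: supp_def a_def b_def)
  \<comment> \<open>As \<open>w'\<close> lies in the support of \<open>v\<close>, its degree is at
    most that of \<open>v\<close>, so all four degrees agree.\<close>
  have d: "card (G.nbrs v) = d" "card (H.nbrs v') = d" "card (H.nbrs w') = d"
    using supp_degree(1)[OF v(1) supp'(1)] le v w by (auto simp: d_def)
  \<comment> \<open>Vertices of degree \<open>d\<close> in one support dominate each other.
    Domination of \<open>v'\<close> by \<open>u\<close> gives an edge \<open>uw'\<close>, and
    domination of \<open>w'\<close> by \<open>v'\<close> then gives an edge
    \<open>v'u\<close>.\<close>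
  have indep: "u \<notin> supp v \<and> u \<notin> supp w"
    if u: "card (H.nbrs u) = d" "u \<noteq> v'" "(v', u) \<notin> E'" for u
  proof -
    have False if x: "x = v \<or> x = w" "u \<in> supp x" for x
    proof -
      have x': "x \<in> V" "v' \<in> supp x" "w' \<in> supp x" "card (G.nbrs x) = d"
        using x v w supp' d by (auto simp: d_def)
      have "H.nbrs v' \<subseteq> insert u (H.nbrs u)"
        using supp_degree(2)[OF x'(1) x(2), of v'] x' u by simp
      moreover have "w' \<noteq> u" using edge u by auto
      ultimately have "(w', u) \<in> E'" using edge H.E_sym by auto
      moreover have "H.nbrs u \<subseteq> insert v' (H.nbrs v')" "H.nbrs w' \<subseteq> insert v' (H.nbrs v')"
        using supp_degree(2)[OF x'(1) x'(2)] x' d x by simp_all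
      ultimately show False using u by auto
    qed
    then show ?thesis by blast
  qed
  \<comment> \<open>Chosen so that \<open>\<phi> c\<close>, congruent to
    \<open>a v' * b - b v' * a\<close>, vanishes at \<open>v'\<close>, at its neighbours by
    \<open>perp\<close>, and at the other vertices of degree \<open>d\<close> by
    \<open>indep\<close>.\<close>
  define c where "c = (\<lambda>x. a v' * basis_vec w x + (- b v') * basis_vec v x)"
  have high: "[\<phi> c u = 0] (mod int p)" if u: "u \<in> V'" "card (H.nbrs u) \<ge> d" for u
  proof -
    have deg_u: "u \<notin> supp v \<and> u \<notin> supp w \<or> card (H.nbrs u) = d"
      using u(2) supp_degree(1)[OF v(1)] supp_degree(1)[OF w(1)] d(1) unfolding d_def
      by (metis le_antisym)
    have "[\<phi> c u = \<phi> (\<lambda>x. a v' * basis_vec w x) u + (- b v') * \<phi> (basis_vec v) u] (mod int p)"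
      unfolding c_def using u(1) by (rule \<phi>_lin)
    also have "[\<phi> (\<lambda>x. a v' * basis_vec w x) u + (- b v') * \<phi> (basis_vec v) u
        = a v' * b u + (- b v') * a u] (mod int p)"
      unfolding a_def b_def using u(1) by (intro cong_add \<phi>_scale cong_refl)
    also have "[a v' * b u + (- b v') * a u = 0] (mod int p)"
    proof -
      consider "u = v'" | "(v', u) \<in> E'" | "u \<notin> supp v \<and> u \<notin> supp w"
        using indep[of u] deg_u by blast
      then show ?thesis
      proof cases
        case 2
        then have "[a v' * b u = a u * b v'] (mod int p)" using perp by (auto simp: perp_def)
        then show ?thesis by (simp add: cong_iff_dvd_diff mult.commute)
      next
        case 3
        then show ?thesis using u by (auto simp: supp_def a_def b_def cong_0_iff)
      qed (simp add: mult.commute)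
    qed
    finally show ?thesis .
  qed
  \<comment> \<open>\<open>\<psi>\<close> cannot raise degrees either, and \<open>w\<close> has
    degree \<open>d\<close>.\<close>
  have low: "[\<psi> (basis_vec u) w = 0] (mod int p)" if u: "u \<in> V'" "card (H.nbrs u) < d" for u
    using S.supp_degree(1)[OF u(1), of w] u w(1) by (auto simp: S.supp_def cong_0_iff d_def)
  have "[\<psi> (\<phi> c) w = 0] (mod int p)"
  proof (rule S.\<phi>_vanish[OF _ _ _ w(1)])
    show "finite {u \<in> V'. card (H.nbrs u) < d}" using H.fin_V by simp
    show "[\<phi> c u = 0] (mod int p)" if "u \<in> V' - {u \<in> V'. card (H.nbrs u) < d}" for u
      using that high[of u] by (simp add: not_less)
    show "[\<psi> (basis_vec u) w = 0] (mod int p)" if "u \<in> {u \<in> V'. card (H.nbrs u) < d}" for u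
      using that low[of u] by simp
  qed
  then have "[c w = 0] (mod int p)"
    using \<psi>_\<phi>[OF w(1), of c] by (simp add: cong_def)
  \<comment> \<open>Since \<open>v \<noteq> w\<close>, the value \<open>c w\<close> is
    \<open>a v'\<close>, a unit mod \<open>p\<close>.\<close>
  then show False using nz \<open>v \<noteq> w\<close> by (simp add: c_def basis_vec_def cong_0_iff)
qed

lemma matching: "\<exists>\<sigma>. bij_betw \<sigma> V V' \<and> (\<forall>v\<in>V. \<sigma> v \<in> supp v)"
proof -
  have "\<exists>\<sigma>. inj_on \<sigma> V \<and> (\<forall>v\<in>V. \<sigma> v \<in> supp v)"
    using G.fin_V H.fin_V hall_supp by (intro hall_marriage) (auto simp: supp_def)
  then obtain \<sigma> where \<sigma>: "inj_on \<sigma> V" "\<And>v. v \<in> V \<Longrightarrow> \<sigma> v \<in> supp v" by blast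
  have "\<sigma> ` V \<subseteq> V'" using \<sigma>(2) by (auto simp: supp_def)
  then have "\<sigma> ` V = V'" using card_V H.fin_V by (intro card_subset_eq) (simp_all add: card_image \<sigma>(1))
  then show ?thesis using \<sigma> by (auto simp: bij_betw_def)
qed

lemma sum_degrees_matching:
  assumes "bij_betw \<sigma> V V'"
  shows "card E' = (\<Sum>v\<in>V. card (H.nbrs (\<sigma> v)))"
  using sum.reindex_bij_betw[OF assms, of "\<lambda>u. card (H.nbrs u)"] H.card_E by simp

lemma card_E_le: "card E' \<le> card E"
proof -
  obtain \<sigma> where \<sigma>: "bij_betw \<sigma> V V'" "\<forall>v\<in>V. \<sigma> v \<in> supp v" using matching by blast
  then show ?thesis
    unfolding sum_degrees_matching[OF \<sigma>(1)] G.card_E by (intro sum_mono supp_degree(1)) auto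
qed

theorem graphs_isomorphic:
  "\<exists>\<sigma>. bij_betw \<sigma> V V' \<and> (\<forall>v\<in>V. \<forall>w\<in>V. (v, w) \<in> E \<longleftrightarrow> (\<sigma> v, \<sigma> w) \<in> E')"
proof -
  interpret S: perp_equiv p V' E' V E \<psi> \<phi> by (rule perp_equiv_sym)
  have card: "card E = card E'" using card_E_le S.card_E_le by simp
  obtain \<sigma> where \<sigma>: "bij_betw \<sigma> V V'" "\<And>v. v \<in> V \<Longrightarrow> \<sigma> v \<in> supp v" using matching by blast
  \<comment> \<open>Both edge sets have the same size, so the two degree sums agree, and termwise
    inequalities between them must be equalities.\<close>
  have deg: "card (H.nbrs (\<sigma> v)) = card (G.nbrs v)" if "v \<in> V" for v
    using sum_mono_inv[of "\<lambda>v. card (H.nbrs (\<sigma> v))" V "\<lambda>v. card (G.nbrs v)" v] that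
      supp_degree(1) \<sigma>(2) G.fin_V card G.card_E sum_degrees_matching[OF \<sigma>(1)] by simp
  \<comment> \<open>\<open>edge_if_supp_edge\<close> wants the vertex of smaller degree first; the
    other order is reached by symmetry of the edge sets.\<close>
  have reflect: "(v, w) \<in> E" if vw: "v \<in> V" "w \<in> V" "(\<sigma> v, \<sigma> w) \<in> E'" for v w
  proof -
    have "v \<noteq> w" using vw H.E_irrefl by auto
    then show ?thesis
      using edge_if_supp_edge[of v "\<sigma> v" w "\<sigma> w"] edge_if_supp_edge[of w "\<sigma> w" v "\<sigma> v"]
        vw \<sigma>(2) deg G.E_sym H.E_sym by (metis nle_le)
  qed
  let ?F = "map_prod \<sigma> \<sigma>"
  have finE: "finite E" using G.E_sub G.fin_V by (meson finite_SigmaI finite_subset)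
  have inj: "inj_on ?F (V \<times> V)"
    using \<sigma>(1) by (auto simp: bij_betw_def intro: map_prod_inj_on)
  \<comment> \<open>Reflecting edges puts \<open>E'\<close> inside the image of \<open>E\<close>.
    Equal sizes turn this into an equality, so \<open>\<sigma>\<close> preserves edges as
    well.\<close>
  have "E' \<subseteq> ?F ` E"
  proof clarify
    fix x y assume "(x, y) \<in> E'"
    moreover then have "x \<in> \<sigma> ` V" "y \<in> \<sigma> ` V" using H.E_sub \<sigma>(1) by (auto simp: bij_betw_def)
    ultimately show "(x, y) \<in> ?F ` E" using reflect by force
  qed
  moreover have "card (?F ` E) = card E"
    using inj G.E_sub by (intro card_image) (auto intro: inj_on_subset)
  ultimately have "E' = ?F ` E" using card finE by (intro card_subset_eq) auto
  then have "(\<sigma> v, \<sigma> w) \<in> E'" if "(v, w) \<in> E" for v w using that by force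
  then show ?thesis using \<sigma>(1) reflect by blast
qed

end

section \<open>Homomorphisms out of pro-\<open>p\<close> completions\<close>

text \<open>The quotient by the kernel is isomorphic to the image, whose order divides
  \<open>p ^ k\<close> by Lagrange's theorem and so is a power of \<open>p\<close>.\<close>

lemma kernel_in_p_quotient_kernels:
  assumes "prime p" "group G" "group P" "h \<in> hom G P" and card: "card (carrier P) = p ^ k"
  shows "kernel G P h \<in> p_quotient_kernels p G"
proof -
  interpret h: group_hom G P h
    using assms by (simp add: group_hom_def group_hom_axioms_def)
  \<comment> \<open>The codomain is cut down to the image because the first isomorphism theorem
    wants a surjection.\<close>
  let ?I = "P\<lparr>carrier := h ` carrier G\<rparr>"
  have fin: "finite (carrier P)"
    using card prime_gt_0_nat[OF assms(1)] by (intro card_ge_0_finite) simp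
  have sub: "subgroup (h ` carrier G) P" by (rule h.img_is_subgroup)
  have "group_hom G ?I h"
    using assms(2,4) h.H.subgroup_imp_group[OF sub]
    by (auto simp: group_hom_def group_hom_axioms_def hom_def)
  then have "(\<lambda>X. the_elem (h ` X)) \<in> iso (G Mod kernel G ?I h) ?I"
    by (rule group_hom.FactGroup_iso_set) simp
  moreover have "kernel G ?I h = kernel G P h" by (simp add: kernel_def)
  ultimately have bij: "bij_betw (\<lambda>X. the_elem (h ` X)) (carrier (G Mod kernel G P h)) (h ` carrier G)"
    by (simp add: iso_def)
  have "finite (h ` carrier G)" using fin subgroup.subset[OF sub] finite_subset by blast
  then have "finite (carrier (G Mod kernel G P h))" using bij_betw_finite[OF bij] by simp
  moreover have "order (G Mod kernel G P h) = card (h ` carrier G)"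
    using bij_betw_same_card[OF bij] by (simp add: order_def)
  moreover have "card (h ` carrier G) dvd p ^ k"
    using h.H.lagrange[OF sub] card by (metis dvd_triv_right order_def)
  ultimately show ?thesis
    using h.normal_kernel divides_primepow_nat[OF assms(1)] by (auto simp: p_quotient_kernels_def)
qed

lemma p_quotient_kernels_normal: "N \<in> p_quotient_kernels p G \<Longrightarrow> N \<lhd> G"
  by (simp add: p_quotient_kernels_def)

lemma p_quotient_kernels_group_Mod: "N \<in> p_quotient_kernels p G \<Longrightarrow> group (G Mod N)"
  by (rule normal.factorgroup_is_group) (rule p_quotient_kernels_normal)

lemma p_quotient_kernels_card:
  "N \<in> p_quotient_kernels p G \<Longrightarrow> \<exists>k. card (carrier (G Mod N)) = p ^ k"
  by (simp add: p_quotient_kernels_def order_def)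

lemma carrier_in_p_quotient_kernels:
  assumes "prime p" "group G"
  shows "carrier G \<in> p_quotient_kernels p G"
proof -
  have "kernel G (integer_mod_group 1) (\<lambda>_. 0) \<in> p_quotient_kernels p G"
    using assms by (intro kernel_in_p_quotient_kernels[where k = 0])
      (auto simp: carrier_integer_mod_group hom_def)
  then show ?thesis by (simp add: kernel_def)
qed

lemma normal_rcos_eq_iff:
  assumes "N \<lhd> G" "g \<in> carrier G"
  shows "N #>\<^bsub>G\<^esub> g = N \<longleftrightarrow> g \<in> N"
proof -
  interpret normal N G by fact
  show ?thesis using rcos_self[OF assms(2)] rcos_const is_group subgroup_axioms by metis
qed

text \<open>The intersection is the kernel of the map to the product of both quotients.\<close>

lemma p_quotient_kernels_Int:
  assumes "prime p" "group G" and N: "N \<in> p_quotient_kernels p G" and M: "M \<in> p_quotient_kernels p G"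
  shows "N \<inter> M \<in> p_quotient_kernels p G"
proof -
  note normal = p_quotient_kernels_normal[OF N] p_quotient_kernels_normal[OF M]
  let ?P = "(G Mod N) \<times>\<times> (G Mod M)"
  let ?h = "\<lambda>g. (N #>\<^bsub>G\<^esub> g, M #>\<^bsub>G\<^esub> g)"
  obtain k l where kl: "card (carrier (G Mod N)) = p ^ k" "card (carrier (G Mod M)) = p ^ l"
    using p_quotient_kernels_card N M by blast
  have "?h \<in> hom G ?P"
    using normal.r_coset_hom_Mod[OF normal(1)] normal.r_coset_hom_Mod[OF normal(2)]
    by (auto simp: hom_def)
  moreover have "group ?P"
    using N M by (intro DirProd_group p_quotient_kernels_group_Mod)
  moreover have "card (carrier ?P) = p ^ (k + l)"
    by (simp add: card_cartesian_product kl power_add)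
  ultimately have "kernel G ?P ?h \<in> p_quotient_kernels p G"
    using assms(1,2) kernel_in_p_quotient_kernels by blast
  moreover have "kernel G ?P ?h = {g \<in> carrier G. g \<in> N \<and> g \<in> M}"
    by (simp add: kernel_def normal_rcos_eq_iff[OF normal(1)] normal_rcos_eq_iff[OF normal(2)] cong: conj_cong)
  moreover have "\<dots> = N \<inter> M"
    using normal[THEN normal_imp_subgroup, THEN subgroup.subset] by blast
  ultimately show ?thesis by simp
qed

text \<open>Basic open sets of the product topology constrain finitely many coordinates;
  directedness of the system controls all of them at one level \<open>M\<close>.\<close>

lemma p_quotient_kernels_lower_bound:
  assumes "prime p" "group G" "finite F" "F \<subseteq> p_quotient_kernels p G"
  shows "\<exists>M\<in>p_quotient_kernels p G. \<forall>N\<in>F. M \<subseteq> N"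
  using assms(3,4)
proof (induction F rule: finite_induct)
  case empty
  then show ?case using carrier_in_p_quotient_kernels[OF assms(1,2)] by blast
next
  case (insert N F)
  then obtain M where "M \<in> p_quotient_kernels p G" "\<forall>N\<in>F. M \<subseteq> N" by auto
  then show ?case
    using insert.prems p_quotient_kernels_Int[OF assms(1,2), of N M] by (intro bexI[of _ "N \<inter> M"]) auto
qed

section \<open>Elements of the completion\<close>

lemma mult_pro_p_completion:
  "N \<in> p_quotient_kernels p G \<Longrightarrow> (x \<otimes>\<^bsub>pro_p_completion p G\<^esub> y) N = x N <#>\<^bsub>G\<^esub> y N"
  by (simp add: pro_p_completion_def)

lemma one_pro_p_completion:
  "N \<in> p_quotient_kernels p G \<Longrightarrow> \<one>\<^bsub>pro_p_completion p G\<^esub> N = N"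
  by (simp add: pro_p_completion_def)

lemma carrier_pro_p_completion: "carrier (pro_p_completion p G) = pro_p_carrier p G"
  by (simp add: pro_p_completion_def)

lemma pro_p_carrier_coset:
  assumes "x \<in> carrier (pro_p_completion p G)" "N \<in> p_quotient_kernels p G"
  obtains g where "g \<in> carrier G" "x N = N #>\<^bsub>G\<^esub> g"
  using assms by (auto simp: carrier_pro_p_completion pro_p_carrier_def carrier_FactGroup PiE_iff)

text \<open>By compatibility of the coordinates, a representative found at a fine level serves at
  every coarser one.\<close>

lemma pro_p_carrier_coset_mono:
  assumes "group G" "x \<in> carrier (pro_p_completion p G)"
    and "N \<in> p_quotient_kernels p G" "M \<in> p_quotient_kernels p G" "N \<subseteq> M"
    and "g \<in> carrier G" "x N = N #>\<^bsub>G\<^esub> g"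
  shows "x M = M #>\<^bsub>G\<^esub> g"
proof -
  have "x M = M <#>\<^bsub>G\<^esub> x N"
    using assms(2-5) by (auto simp: carrier_pro_p_completion pro_p_carrier_def)
  then show ?thesis
    using coset_projection[OF assms(1) _ _ assms(5,6)] assms(3,4,7) p_quotient_kernels_normal by metis
qed

lemma pro_p_projection_hom:
  assumes "N \<in> p_quotient_kernels p G"
  shows "(\<lambda>x. x N) \<in> hom (pro_p_completion p G) (G Mod N)"
  using assms by (auto simp: hom_def mult_pro_p_completion carrier_pro_p_completion pro_p_carrier_def)

lemma pro_p_completion_eqI:
  assumes "x \<in> carrier (pro_p_completion p G)" "y \<in> carrier (pro_p_completion p G)"
    and "\<And>N. N \<in> p_quotient_kernels p G \<Longrightarrow> x N = y N"
  shows "x = y"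
  using assms by (auto simp: carrier_pro_p_completion pro_p_carrier_def intro: PiE_ext)

text \<open>The canonical homomorphism to the completion; its name makes no claim of
  injectivity.\<close>

definition pro_p_embed :: "nat \<Rightarrow> ('g, 'm) monoid_scheme \<Rightarrow> 'g \<Rightarrow> 'g set \<Rightarrow> 'g set" where
  "pro_p_embed p G g = (\<lambda>N\<in>p_quotient_kernels p G. N #>\<^bsub>G\<^esub> g)"

lemma pro_p_embed_apply [simp]: "N \<in> p_quotient_kernels p G \<Longrightarrow> pro_p_embed p G g N = N #>\<^bsub>G\<^esub> g"
  by (simp add: pro_p_embed_def)

lemma pro_p_embed_closed:
  assumes "group G" "g \<in> carrier G"
  shows "pro_p_embed p G g \<in> carrier (pro_p_completion p G)"
  using assms coset_projection[OF assms(1) p_quotient_kernels_normal p_quotient_kernels_normal]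
  by (auto simp: carrier_pro_p_completion pro_p_carrier_def pro_p_embed_def carrier_FactGroup)

lemma pro_p_embed_hom:
  assumes "group G"
  shows "pro_p_embed p G \<in> hom G (pro_p_completion p G)"
proof (rule homI)
  interpret group G by fact
  interpret C: group "pro_p_completion p G" by (rule group_pro_p_completion) fact
  fix x y assume xy: "x \<in> carrier G" "y \<in> carrier G"
  show "pro_p_embed p G (x \<otimes>\<^bsub>G\<^esub> y) = pro_p_embed p G x \<otimes>\<^bsub>pro_p_completion p G\<^esub> pro_p_embed p G y"
  proof (rule pro_p_completion_eqI)
    fix N assume N: "N \<in> p_quotient_kernels p G"
    then show "pro_p_embed p G (x \<otimes>\<^bsub>G\<^esub> y) N = (pro_p_embed p G x \<otimes>\<^bsub>pro_p_completion p G\<^esub> pro_p_embed p G y) N"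
      using normal.rcos_sum[OF p_quotient_kernels_normal[OF N] xy] by (simp add: mult_pro_p_completion)
  qed (use xy assms in \<open>auto intro: pro_p_embed_closed\<close>)
qed (rule pro_p_embed_closed[OF assms])

text \<open>
  The subgroups \<open>{x. x N = N}\<close> form a neighbourhood basis of the identity. So, for discrete \<open>P\<close>,
  continuity amounts to triviality on one of them.
\<close>

definition cont_homs ::
  "nat \<Rightarrow> ('g, 'm) monoid_scheme \<Rightarrow> ('h, 'n) monoid_scheme \<Rightarrow> (('g set \<Rightarrow> 'g set) \<Rightarrow> 'h) set" where
  "cont_homs p G P = {h \<in> hom (pro_p_completion p G) P. \<exists>N\<in>p_quotient_kernels p G.
    \<forall>x\<in>carrier (pro_p_completion p G). x N = N \<longrightarrow> h x = \<one>\<^bsub>P\<^esub>}"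

text \<open>Elements that agree at \<open>N\<close> differ by one that is trivial at
  \<open>N\<close>, which \<open>h\<close> kills.\<close>

lemma cont_homs_factor:
  assumes "group G" "group P" "h \<in> cont_homs p G P"
  obtains N where "N \<in> p_quotient_kernels p G"
    "\<And>x y. x \<in> carrier (pro_p_completion p G) \<Longrightarrow> y \<in> carrier (pro_p_completion p G) \<Longrightarrow>
      x N = y N \<Longrightarrow> h x = h y"
proof -
  let ?C = "pro_p_completion p G"
  obtain N where N: "N \<in> p_quotient_kernels p G"
    and triv: "\<And>x. x \<in> carrier ?C \<Longrightarrow> x N = N \<Longrightarrow> h x = \<one>\<^bsub>P\<^esub>"
    and hom: "h \<in> hom ?C P"
    using assms(3) unfolding cont_homs_def by blast
  interpret h: group_hom ?C P h
    using assms hom group_pro_p_completion[OF assms(1)] by (simp add: group_hom_def group_hom_axioms_def)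
  interpret q: group_hom ?C "G Mod N" "\<lambda>x. x N"
    using group_pro_p_completion[OF assms(1)] p_quotient_kernels_group_Mod[OF N] pro_p_projection_hom[OF N]
    by (simp add: group_hom_def group_hom_axioms_def)
  have "h x = h y" if x: "x \<in> carrier ?C" and y: "y \<in> carrier ?C" and eq: "x N = y N" for x y
  proof -
    have "(x \<otimes>\<^bsub>?C\<^esub> inv\<^bsub>?C\<^esub> y) N = \<one>\<^bsub>G Mod N\<^esub>"
      using x y eq q.hom_mult[of x "inv\<^bsub>?C\<^esub> y"] q.hom_inv[of y] q.H.r_inv[of "y N"] q.hom_closed[of y]
      by simp
    then have "h (x \<otimes>\<^bsub>?C\<^esub> inv\<^bsub>?C\<^esub> y) = \<one>\<^bsub>P\<^esub>" using triv x y by simp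
    then have "h x \<otimes>\<^bsub>P\<^esub> inv\<^bsub>P\<^esub> h y = \<one>\<^bsub>P\<^esub>" using x y by simp
    then show ?thesis using x y h.H.inv_equality[of "h x" "inv\<^bsub>P\<^esub> h y"] by simp
  qed
  then show thesis using N that by blast
qed

text \<open>Density of the image of \<open>G\<close>: a representative of \<open>x\<close> at the
  intersection of the two levels works for both maps. Having one \<open>g\<close> for both allows
  them to be compared at \<open>x\<close>.\<close>

lemma cont_homs_common_representative:
  assumes "prime p" "group G" "group P" "group Q" "h \<in> cont_homs p G P" "h' \<in> cont_homs p G Q"
    and x: "x \<in> carrier (pro_p_completion p G)"
  obtains g where "g \<in> carrier G" "h x = h (pro_p_embed p G g)" "h' x = h' (pro_p_embed p G g)"
proof -
  let ?C = "pro_p_completion p G"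
  obtain N where N: "N \<in> p_quotient_kernels p G"
    "\<And>x y. x \<in> carrier ?C \<Longrightarrow> y \<in> carrier ?C \<Longrightarrow> x N = y N \<Longrightarrow> h x = h y"
    using cont_homs_factor[OF assms(2,3,5)] by blast
  obtain N' where N': "N' \<in> p_quotient_kernels p G"
    "\<And>x y. x \<in> carrier ?C \<Longrightarrow> y \<in> carrier ?C \<Longrightarrow> x N' = y N' \<Longrightarrow> h' x = h' y"
    using cont_homs_factor[OF assms(2,4,6)] by blast
  have M: "N \<inter> N' \<in> p_quotient_kernels p G"
    using assms(1,2) N(1) N'(1) by (rule p_quotient_kernels_Int)
  obtain g where g: "g \<in> carrier G" "x (N \<inter> N') = (N \<inter> N') #>\<^bsub>G\<^esub> g"
    using pro_p_carrier_coset[OF x M] .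
  have gc: "pro_p_embed p G g \<in> carrier ?C" using assms(2) g(1) by (rule pro_p_embed_closed)
  have "x N = pro_p_embed p G g N" "x N' = pro_p_embed p G g N'"
    using pro_p_carrier_coset_mono[OF assms(2) x M _ _ g] N(1) N'(1) by auto
  then have "h x = h (pro_p_embed p G g)" "h' x = h' (pro_p_embed p G g)"
    using N(2)[OF x gc] N'(2)[OF x gc] by auto
  then show thesis using that g(1) by blast
qed

lemma cont_homs_eqI:
  assumes "prime p" "group G" "group P" "h \<in> cont_homs p G P" "h' \<in> cont_homs p G P"
    and "\<And>g. g \<in> carrier G \<Longrightarrow> h (pro_p_embed p G g) = h' (pro_p_embed p G g)"
    and "x \<in> carrier (pro_p_completion p G)"
  shows "h x = h' x"
  using cont_homs_common_representative[OF assms(1-3,3-5,7)] assms(6) by metis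

text \<open>As \<open>P\<close> is a finite \<open>p\<close>-group, the kernel of
  \<open>h\<^sub>0\<close> is one of the levels, and \<open>h\<^sub>0\<close> factors through the
  coordinate there.\<close>

lemma cont_homs_extend:
  assumes "prime p" "group G" "group P" "h\<^sub>0 \<in> hom G P" "card (carrier P) = p ^ k"
  shows "\<exists>h\<in>cont_homs p G P. \<forall>g\<in>carrier G. h (pro_p_embed p G g) = h\<^sub>0 g"
proof -
  let ?C = "pro_p_completion p G"
  interpret h: group_hom G P h\<^sub>0
    using assms by (simp add: group_hom_def group_hom_axioms_def)
  let ?N = "kernel G P h\<^sub>0"
  have N: "?N \<in> p_quotient_kernels p G" using assms by (rule kernel_in_p_quotient_kernels)
  \<comment> \<open>\<open>h\<^sub>0\<close> is constant on each coset of its kernel;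
    \<open>the_elem\<close> picks that value.\<close>
  let ?h = "(\<lambda>X. the_elem (h\<^sub>0 ` X)) \<circ> (\<lambda>x. x ?N)"
  have "?h \<in> hom ?C P"
    using pro_p_projection_hom[OF N] h.FactGroup_hom by (rule hom_compose)
  moreover have "\<forall>x\<in>carrier ?C. x ?N = ?N \<longrightarrow> ?h x = \<one>\<^bsub>P\<^esub>"
    using hom_one[OF h.FactGroup_hom p_quotient_kernels_group_Mod[OF N] assms(3)] by simp
  ultimately have "?h \<in> cont_homs p G P" using N unfolding cont_homs_def by blast
  moreover have "?h (pro_p_embed p G g) = h\<^sub>0 g" if g: "g \<in> carrier G" for g
  proof -
    have "g \<in> ?N #>\<^bsub>G\<^esub> g"
      using g N p_quotient_kernels_normal normal_imp_subgroup by (intro h.G.rcos_self) blast+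
    then have "h\<^sub>0 ` (?N #>\<^bsub>G\<^esub> g) = {h\<^sub>0 g}"
      using g by (auto simp: r_coset_def kernel_def image_iff)
    then show ?thesis using N by simp
  qed
  ultimately show ?thesis by blast
qed

lemma cont_homs_comp_hom:
  assumes "group P" "group Q" "h \<in> cont_homs p G P" "q \<in> hom P Q"
  shows "q \<circ> h \<in> cont_homs p G Q"
  using assms hom_one[OF assms(4,1,2)] hom_compose[of h _ P q Q]
  unfolding cont_homs_def by fastforce

text \<open>The elements that \<open>f\<close> sends into the basic subgroup at \<open>N\<close>
  form an open neighbourhood of the identity. It contains all elements trivial at some level
  \<open>M\<close>, which witnesses continuity of the composite.\<close>

lemma cont_homs_comp_continuous:
  assumes "prime p" "group G" "group G'" "h \<in> cont_homs p G P"
    and f: "f \<in> hom (pro_p_completion p G') (pro_p_completion p G)"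
    and cont: "continuous_map (pro_p_topology p G') (pro_p_topology p G) f"
  shows "h \<circ> f \<in> cont_homs p G' P"
proof -
  let ?C = "pro_p_completion p G" and ?C' = "pro_p_completion p G'"
  let ?K = "p_quotient_kernels p G" and ?K' = "p_quotient_kernels p G'"
  obtain N where N: "N \<in> ?K" and triv: "\<And>x. x \<in> carrier ?C \<Longrightarrow> x N = N \<Longrightarrow> h x = \<one>\<^bsub>P\<^esub>"
    and hom: "h \<in> hom ?C P"
    using assms(4) unfolding cont_homs_def by blast
  interpret f: group_hom ?C' ?C f
    using f group_pro_p_completion[OF assms(2)] group_pro_p_completion[OF assms(3)]
    by (simp add: group_hom_def group_hom_axioms_def)
  have proj: "continuous_map (pro_p_topology p G) (discrete_topology (carrier (G Mod N))) (\<lambda>x. x N)"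
    unfolding pro_p_topology_def
    using N by (intro continuous_map_from_subtopology continuous_map_product_projection)
  have "N \<in> carrier (G Mod N)"
    using monoid.one_closed[OF group.is_monoid[OF p_quotient_kernels_group_Mod[OF N]]] by simp
  then have opn: "openin (pro_p_topology p G) {x \<in> carrier ?C. x N \<in> {N}}"
    using openin_continuous_map_preimage[OF proj, of "{N}"] by (simp add: topspace_pro_p_topology)
  have "openin (pro_p_topology p G') {x \<in> carrier ?C'. f x \<in> {x \<in> carrier ?C. x N \<in> {N}}}"
    using openin_continuous_map_preimage[OF cont opn] by (simp only: topspace_pro_p_topology)
  then obtain T where T: "openin (product_topology (\<lambda>N. discrete_topology (carrier (G' Mod N))) ?K') T"
    and eq: "{x \<in> carrier ?C'. f x \<in> {x \<in> carrier ?C. x N \<in> {N}}} = T \<inter> carrier ?C'"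
    unfolding pro_p_topology_def openin_subtopology carrier_pro_p_completion by blast
  have "\<one>\<^bsub>?C'\<^esub> \<in> T"
    using eq f.hom_one f.one_closed f.H.one_closed one_pro_p_completion[OF N] by auto
  then obtain U where U: "finite {i \<in> ?K'. U i \<noteq> carrier (G' Mod i)}"
    "\<one>\<^bsub>?C'\<^esub> \<in> Pi\<^sub>E ?K' U" "Pi\<^sub>E ?K' U \<subseteq> T"
    using T unfolding openin_product_topology_alt by auto
  \<comment> \<open>\<open>M\<close> lies below the finitely many levels where \<open>U\<close> is a
    real restriction, so an element trivial at \<open>M\<close> is trivial at all of those.\<close>
  then obtain M where M: "M \<in> ?K'" "\<And>i. i \<in> ?K' \<Longrightarrow> U i \<noteq> carrier (G' Mod i) \<Longrightarrow> M \<subseteq> i"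
    using p_quotient_kernels_lower_bound[OF assms(1,3) U(1)] by auto
  have "(h \<circ> f) x = \<one>\<^bsub>P\<^esub>" if x: "x \<in> carrier ?C'" "x M = M" for x
  proof -
    interpret G': group G' by fact
    have "x i \<in> U i" if i: "i \<in> ?K'" for i
    proof (cases "U i = carrier (G' Mod i)")
      case True
      then show ?thesis using x i by (auto simp: carrier_pro_p_completion pro_p_carrier_def)
    next
      case False
      have "x M = M #>\<^bsub>G'\<^esub> \<one>\<^bsub>G'\<^esub>"
        using x(2) normal_rcos_eq_iff[OF p_quotient_kernels_normal[OF M(1)] G'.one_closed]
          subgroup.one_closed[OF normal_imp_subgroup[OF p_quotient_kernels_normal[OF M(1)]]] by simp
      then have "x i = i #>\<^bsub>G'\<^esub> \<one>\<^bsub>G'\<^esub>"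
        using pro_p_carrier_coset_mono[OF assms(3) x(1) M(1) i M(2)[OF i False]] by simp
      also have "\<dots> = i"
        using normal_rcos_eq_iff[OF p_quotient_kernels_normal[OF i] G'.one_closed]
          subgroup.one_closed[OF normal_imp_subgroup[OF p_quotient_kernels_normal[OF i]]] by simp
      finally show ?thesis using U(2) i one_pro_p_completion[OF i] by (auto simp: PiE_iff)
    qed
    then have "x \<in> Pi\<^sub>E ?K' U"
      using x(1) by (auto simp: carrier_pro_p_completion pro_p_carrier_def PiE_iff)
    then have "x \<in> T" using U(3) by blast
    then have "x \<in> {x \<in> carrier ?C'. f x \<in> {x \<in> carrier ?C. x N \<in> {N}}}"
      unfolding eq using x(1) by blast
    then show ?thesis using triv[of "f x"] by simp
  qed
  then show ?thesis
    using M(1) hom_compose[OF f hom] by (auto simp: cont_homs_def)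
qed

section \<open>Functoriality of the completion\<close>

text \<open>The coordinate of \<open>x\<close> at the preimage of \<open>N\<close> is pushed
  forward. As \<open>\<theta>\<close> need not be surjective, the image of a coset may be smaller
  than a coset of \<open>N\<close>; multiplying by \<open>N\<close> fills it up.\<close>

definition pro_p_map ::
  "nat \<Rightarrow> ('g, 'm) monoid_scheme \<Rightarrow> ('h, 'n) monoid_scheme \<Rightarrow> ('g \<Rightarrow> 'h) \<Rightarrow>
    ('g set \<Rightarrow> 'g set) \<Rightarrow> 'h set \<Rightarrow> 'h set" where
  "pro_p_map p G G' \<theta> x = (\<lambda>N\<in>p_quotient_kernels p G'. N <#>\<^bsub>G'\<^esub> \<theta> ` x {g \<in> carrier G. \<theta> g \<in> N})"

text \<open>The preimage is the kernel of \<open>\<theta>\<close> followed by the projection to the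
  quotient by \<open>N\<close>.\<close>

lemma p_quotient_kernels_vimage:
  assumes "prime p" "group G" "group G'" "\<theta> \<in> hom G G'" and N: "N \<in> p_quotient_kernels p G'"
  shows "{g \<in> carrier G. \<theta> g \<in> N} \<in> p_quotient_kernels p G"
proof -
  have "(\<lambda>a. N #>\<^bsub>G'\<^esub> a) \<circ> \<theta> \<in> hom G (G' Mod N)"
    using assms(4) normal.r_coset_hom_Mod[OF p_quotient_kernels_normal[OF N]] by (rule hom_compose)
  then have "kernel G (G' Mod N) ((\<lambda>a. N #>\<^bsub>G'\<^esub> a) \<circ> \<theta>) \<in> p_quotient_kernels p G"
    using assms p_quotient_kernels_card[OF N] p_quotient_kernels_group_Mod[OF N]
      kernel_in_p_quotient_kernels by blast
  moreover have "kernel G (G' Mod N) ((\<lambda>a. N #>\<^bsub>G'\<^esub> a) \<circ> \<theta>) = {g \<in> carrier G. \<theta> g \<in> N}"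
    using normal_rcos_eq_iff[OF p_quotient_kernels_normal[OF N]] assms(4) by (auto simp: kernel_def hom_def)
  ultimately show ?thesis by simp
qed

text \<open>Describing the map on representatives reduces compatibility and multiplicativity to
  coset computations.\<close>

lemma pro_p_map_apply:
  assumes "group G" "group G'" "\<theta> \<in> hom G G'" and N: "N \<in> p_quotient_kernels p G'"
    and g: "g \<in> carrier G" "x {g \<in> carrier G. \<theta> g \<in> N} = {g \<in> carrier G. \<theta> g \<in> N} #>\<^bsub>G\<^esub> g"
  shows "pro_p_map p G G' \<theta> x N = N #>\<^bsub>G'\<^esub> \<theta> g"
proof -
  interpret \<theta>: group_hom G G' \<theta>
    using assms by (simp add: group_hom_def group_hom_axioms_def)
  interpret N: normal N G' by (rule p_quotient_kernels_normal[OF N])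
  let ?A = "\<theta> ` ({g \<in> carrier G. \<theta> g \<in> N} #>\<^bsub>G\<^esub> g)"
  have "?A \<subseteq> N #>\<^bsub>G'\<^esub> \<theta> g"
    using g by (auto simp: r_coset_def)
  then have "N <#>\<^bsub>G'\<^esub> ?A \<subseteq> N <#>\<^bsub>G'\<^esub> (N #>\<^bsub>G'\<^esub> \<theta> g)"
    by (rule mono_set_mult[OF subset_refl])
  also have "N <#>\<^bsub>G'\<^esub> (N #>\<^bsub>G'\<^esub> \<theta> g) = N #>\<^bsub>G'\<^esub> \<theta> g"
    using N.subset g by (simp add: \<theta>.H.setmult_rcos_assoc \<theta>.H.subgroup_mult_id N.subgroup_axioms)
  finally have sub: "N <#>\<^bsub>G'\<^esub> ?A \<subseteq> N #>\<^bsub>G'\<^esub> \<theta> g" .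
  have "\<theta> g \<in> ?A"
    using g by (auto simp: r_coset_def intro!: image_eqI[of _ _ g] exI[of _ "\<one>\<^bsub>G\<^esub>"])
  then have "N #>\<^bsub>G'\<^esub> \<theta> g \<subseteq> N <#>\<^bsub>G'\<^esub> ?A"
    unfolding set_mult_def r_coset_def by blast
  with sub have "N <#>\<^bsub>G'\<^esub> ?A = N #>\<^bsub>G'\<^esub> \<theta> g" by (rule equalityI)
  then show ?thesis using N g by (simp add: pro_p_map_def)
qed

lemma pro_p_map_closed:
  assumes "prime p" "group G" "group G'" "\<theta> \<in> hom G G'" and x: "x \<in> carrier (pro_p_completion p G)"
  shows "pro_p_map p G G' \<theta> x \<in> carrier (pro_p_completion p G')"
proof -
  have "pro_p_map p G G' \<theta> x N \<in> carrier (G' Mod N)" if N: "N \<in> p_quotient_kernels p G'" for N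
  proof -
    obtain g where g: "g \<in> carrier G"
      "x {g \<in> carrier G. \<theta> g \<in> N} = {g \<in> carrier G. \<theta> g \<in> N} #>\<^bsub>G\<^esub> g"
      using pro_p_carrier_coset[OF x p_quotient_kernels_vimage[OF assms(1-4) N]] .
    then show ?thesis
      unfolding pro_p_map_apply[where x = x, OF assms(2-4) N g] carrier_FactGroup
      using hom_in_carrier[OF assms(4)] by blast
  qed
  moreover have "M <#>\<^bsub>G'\<^esub> pro_p_map p G G' \<theta> x N = pro_p_map p G G' \<theta> x M"
    if NM: "N \<in> p_quotient_kernels p G'" "M \<in> p_quotient_kernels p G'" "N \<subseteq> M" for N M
  proof -
    let ?N = "{g \<in> carrier G. \<theta> g \<in> N}" and ?M = "{g \<in> carrier G. \<theta> g \<in> M}"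
    have K: "?N \<in> p_quotient_kernels p G" "?M \<in> p_quotient_kernels p G"
      using p_quotient_kernels_vimage[OF assms(1-4)] NM by auto
    obtain g where g: "g \<in> carrier G" "x ?N = ?N #>\<^bsub>G\<^esub> g"
      using pro_p_carrier_coset[OF x K(1)] .
    have "x ?M = ?M #>\<^bsub>G\<^esub> g"
      using pro_p_carrier_coset_mono[OF assms(2) x K _ g] NM by auto
    then show ?thesis
      using pro_p_map_apply[where x = x, OF assms(2-4) NM(1) g]
        pro_p_map_apply[where x = x, OF assms(2-4) NM(2) g(1)]
        coset_projection[OF assms(3) NM(1,2)[THEN p_quotient_kernels_normal] NM(3)
          hom_in_carrier[OF assms(4) g(1)]]
      by simp
  qed
  ultimately show ?thesis
    unfolding carrier_pro_p_completion pro_p_carrier_def by (auto simp: pro_p_map_def)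
qed

lemma pro_p_map_hom:
  assumes "prime p" "group G" "group G'" "\<theta> \<in> hom G G'"
  shows "pro_p_map p G G' \<theta> \<in> hom (pro_p_completion p G) (pro_p_completion p G')"
proof (rule homI)
  let ?C = "pro_p_completion p G" and ?C' = "pro_p_completion p G'"
  interpret G: group G by fact
  interpret C: group ?C by (rule group_pro_p_completion) fact
  interpret C': group ?C' by (rule group_pro_p_completion) fact
  fix x y assume xy: "x \<in> carrier ?C" "y \<in> carrier ?C"
  show "pro_p_map p G G' \<theta> (x \<otimes>\<^bsub>?C\<^esub> y) = pro_p_map p G G' \<theta> x \<otimes>\<^bsub>?C'\<^esub> pro_p_map p G G' \<theta> y"
  proof (rule pro_p_completion_eqI)
    fix N assume N: "N \<in> p_quotient_kernels p G'"
    let ?N = "{g \<in> carrier G. \<theta> g \<in> N}"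
    have K: "?N \<in> p_quotient_kernels p G"
      using p_quotient_kernels_vimage[OF assms N] .
    obtain g where g: "g \<in> carrier G" "x ?N = ?N #>\<^bsub>G\<^esub> g"
      using pro_p_carrier_coset[OF xy(1) K] .
    obtain h where h: "h \<in> carrier G" "y ?N = ?N #>\<^bsub>G\<^esub> h"
      using pro_p_carrier_coset[OF xy(2) K] .
    have "(x \<otimes>\<^bsub>?C\<^esub> y) ?N = ?N #>\<^bsub>G\<^esub> (g \<otimes>\<^bsub>G\<^esub> h)"
      using g h normal.rcos_sum[OF p_quotient_kernels_normal[OF K]] mult_pro_p_completion[OF K] by simp
    then have "pro_p_map p G G' \<theta> (x \<otimes>\<^bsub>?C\<^esub> y) N = N #>\<^bsub>G'\<^esub> \<theta> (g \<otimes>\<^bsub>G\<^esub> h)"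
      using g(1) h(1) by (intro pro_p_map_apply[OF assms(2-4) N]) auto
    also have "\<dots> = (N #>\<^bsub>G'\<^esub> \<theta> g) <#>\<^bsub>G'\<^esub> (N #>\<^bsub>G'\<^esub> \<theta> h)"
      using normal.rcos_sum[OF p_quotient_kernels_normal[OF N]] g(1) h(1) assms(4)
      by (simp add: hom_mult hom_in_carrier)
    finally show "pro_p_map p G G' \<theta> (x \<otimes>\<^bsub>?C\<^esub> y) N =
        (pro_p_map p G G' \<theta> x \<otimes>\<^bsub>?C'\<^esub> pro_p_map p G G' \<theta> y) N"
      using pro_p_map_apply[where x = x, OF assms(2-4) N g] pro_p_map_apply[where x = y, OF assms(2-4) N h]
      by (simp add: mult_pro_p_completion[OF N])
  qed (use xy pro_p_map_closed[OF assms] in auto)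
qed (rule pro_p_map_closed[OF assms])

text \<open>Each coordinate of the image is a function of a single coordinate of \<open>x\<close>,
  and coordinates take values in discrete spaces.\<close>

lemma pro_p_map_continuous:
  assumes "prime p" "group G" "group G'" "\<theta> \<in> hom G G'"
  shows "continuous_map (pro_p_topology p G) (pro_p_topology p G') (pro_p_map p G G' \<theta>)"
proof -
  let ?C' = "pro_p_completion p G'"
  have closed: "pro_p_map p G G' \<theta> x \<in> pro_p_carrier p G'" if "x \<in> topspace (pro_p_topology p G)" for x
    using that pro_p_map_closed[OF assms] by (simp add: topspace_pro_p_topology carrier_pro_p_completion)
  have "continuous_map (pro_p_topology p G) (discrete_topology (carrier (G' Mod N)))
      (\<lambda>x. pro_p_map p G G' \<theta> x N)" if N: "N \<in> p_quotient_kernels p G'" for N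
  proof -
    let ?N = "{g \<in> carrier G. \<theta> g \<in> N}"
    \<comment> \<open>The default \<open>N\<close> makes this a map between the carriers, continuous
      by discreteness; on elements of the completion the default is never taken.\<close>
    let ?r = "\<lambda>A. if N <#>\<^bsub>G'\<^esub> \<theta> ` A \<in> carrier (G' Mod N) then N <#>\<^bsub>G'\<^esub> \<theta> ` A else N"
    have "continuous_map (pro_p_topology p G) (discrete_topology (carrier (G Mod ?N))) (\<lambda>x. x ?N)"
      unfolding pro_p_topology_def using p_quotient_kernels_vimage[OF assms N]
      by (intro continuous_map_from_subtopology continuous_map_product_projection)
    moreover have "continuous_map (discrete_topology (carrier (G Mod ?N)))
        (discrete_topology (carrier (G' Mod N))) ?r"
      using monoid.one_closed[OF group.is_monoid[OF p_quotient_kernels_group_Mod[OF N]]] by auto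
    ultimately have "continuous_map (pro_p_topology p G) (discrete_topology (carrier (G' Mod N)))
        (?r \<circ> (\<lambda>x. x ?N))"
      by (rule continuous_map_compose)
    moreover have "(?r \<circ> (\<lambda>x. x ?N)) x = pro_p_map p G G' \<theta> x N"
      if "x \<in> topspace (pro_p_topology p G)" for x
      using closed[OF that] N by (auto simp: pro_p_map_def pro_p_carrier_def PiE_iff)
    ultimately show ?thesis by (rule continuous_map_eq)
  qed
  then show ?thesis
    unfolding pro_p_topology_def[of p G']
    using closed
    by (auto simp: continuous_map_in_subtopology continuous_map_componentwise
        pro_p_carrier_def PiE_iff)
qed

text \<open>The preimage of the preimage of \<open>N\<close> is \<open>N\<close> itself, so a
  representative \<open>g\<close> at \<open>N\<close> comes back as
  \<open>\<eta> (\<theta> g)\<close>.\<close>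

lemma pro_p_map_inverse:
  assumes "prime p" "group G" "group G'" "\<theta> \<in> hom G G'" "\<eta> \<in> hom G' G"
    and inv: "\<And>g. g \<in> carrier G \<Longrightarrow> \<eta> (\<theta> g) = g" and x: "x \<in> carrier (pro_p_completion p G)"
  shows "pro_p_map p G' G \<eta> (pro_p_map p G G' \<theta> x) = x"
proof (rule pro_p_completion_eqI)
  fix N assume N: "N \<in> p_quotient_kernels p G"
  let ?N = "{g \<in> carrier G'. \<eta> g \<in> N}"
  have K: "?N \<in> p_quotient_kernels p G'"
    using p_quotient_kernels_vimage[OF assms(1,3,2,5) N] .
  have N_eq: "{g \<in> carrier G. \<theta> g \<in> ?N} = N"
    using inv assms(4) N[THEN p_quotient_kernels_normal, THEN normal_imp_subgroup, THEN subgroup.subset]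
    by (auto simp: hom_in_carrier)
  obtain g where g: "g \<in> carrier G" "x N = N #>\<^bsub>G\<^esub> g"
    using pro_p_carrier_coset[OF x N] .
  have "pro_p_map p G G' \<theta> x ?N = ?N #>\<^bsub>G'\<^esub> \<theta> g"
    using g N_eq by (intro pro_p_map_apply[OF assms(2-4) K]) auto
  then have "pro_p_map p G' G \<eta> (pro_p_map p G G' \<theta> x) N = N #>\<^bsub>G\<^esub> \<eta> (\<theta> g)"
    using g assms(4) by (intro pro_p_map_apply[OF assms(3,2,5) N]) (auto simp: hom_in_carrier)
  then show "pro_p_map p G' G \<eta> (pro_p_map p G G' \<theta> x) N = x N" using g inv by simp
next
  show "pro_p_map p G' G \<eta> (pro_p_map p G G' \<theta> x) \<in> carrier (pro_p_completion p G)"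
    by (intro pro_p_map_closed assms)
qed (rule x)

lemma pro_p_completions_isomorphic:
  assumes "prime p" "group G" "group G'" "\<theta> \<in> hom G G'" "\<eta> \<in> hom G' G"
    and "\<And>g. g \<in> carrier G \<Longrightarrow> \<eta> (\<theta> g) = g" "\<And>g. g \<in> carrier G' \<Longrightarrow> \<theta> (\<eta> g) = g"
  shows "topological_groups_isomorphic (pro_p_completion p G) (pro_p_topology p G)
    (pro_p_completion p G') (pro_p_topology p G')"
proof -
  note inv = pro_p_map_inverse[OF assms(1-6)] pro_p_map_inverse[OF assms(1,3,2,5,4,7)]
  note closed = pro_p_map_closed[OF assms(1-4)] pro_p_map_closed[OF assms(1,3,2,5)]
  have "bij_betw (pro_p_map p G G' \<theta>) (carrier (pro_p_completion p G)) (carrier (pro_p_completion p G'))"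
    using inv closed by (intro bij_betw_byWitness[where f' = "pro_p_map p G' G \<eta>"]) auto
  then have "pro_p_map p G G' \<theta> \<in> iso (pro_p_completion p G) (pro_p_completion p G')"
    using pro_p_map_hom[OF assms(1-4)] by (simp add: iso_def)
  moreover have "homeomorphic_maps (pro_p_topology p G) (pro_p_topology p G')
      (pro_p_map p G G' \<theta>) (pro_p_map p G' G \<eta>)"
    using inv pro_p_map_continuous[OF assms(1-4)] pro_p_map_continuous[OF assms(1,3,2,5)]
    by (simp add: homeomorphic_maps_def topspace_pro_p_topology)
  ultimately show ?thesis
    unfolding topological_groups_isomorphic_def using homeomorphic_map_maps by blast
qed

section \<open>Homomorphisms out of presented groups\<close>

definition word_eval :: "('h, 'm) monoid_scheme \<Rightarrow> ('a \<Rightarrow> 'h) \<Rightarrow> 'a word \<Rightarrow> 'h" where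
  "word_eval P k w = foldr (\<lambda>(s, b) x. (if b then k s else inv\<^bsub>P\<^esub> k s) \<otimes>\<^bsub>P\<^esub> x) w \<one>\<^bsub>P\<^esub>"

lemma word_eval_Nil [simp]: "word_eval P k [] = \<one>\<^bsub>P\<^esub>"
  and word_eval_Cons [simp]:
    "word_eval P k ((s, b) # w) = (if b then k s else inv\<^bsub>P\<^esub> k s) \<otimes>\<^bsub>P\<^esub> word_eval P k w"
  by (simp_all add: word_eval_def)

lemma words_Cons [simp]: "(s, b) # w \<in> words S \<longleftrightarrow> s \<in> S \<and> w \<in> words S"
  by (auto simp: words_def)

context group
begin

lemma word_eval_closed [simp]:
  "k \<in> S \<rightarrow> carrier G \<Longrightarrow> w \<in> words S \<Longrightarrow> word_eval G k w \<in> carrier G"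
  by (induction w) (auto simp: Pi_iff)

lemma word_eval_append:
  assumes "k \<in> S \<rightarrow> carrier G" "v \<in> words S" "w \<in> words S"
  shows "word_eval G k (v @ w) = word_eval G k v \<otimes> word_eval G k w"
  using assms(2)
proof (induction v)
  case Nil
  then show ?case using assms by simp
next
  case (Cons x v)
  obtain s b where "x = (s, b)" by (cases x)
  then show ?case using Cons assms by (auto simp: Pi_iff m_assoc)
qed

lemma word_eval_word_eq:
  assumes k: "k \<in> S \<rightarrow> carrier G"
    and rel: "\<And>l r. (l, r) \<in> R \<Longrightarrow> l \<in> words S \<Longrightarrow> r \<in> words S \<Longrightarrow> word_eval G k l = word_eval G k r"
    and "word_eq S R v w"
  shows "word_eval G k v = word_eval G k w"
  using assms(3)
proof (induction rule: word_eq.induct)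
  case (cancel u w s b)
  have "k s \<in> carrier G" using cancel k by auto
  then have "word_eval G k [(s, b), (s, \<not> b)] = \<one>" by simp
  then have "word_eval G k ([(s, b), (s, \<not> b)] @ w) = word_eval G k w"
    using cancel k word_eval_append[OF k, of "[(s, b), (s, \<not> b)]" w] by simp
  then show ?case
    using cancel k by (simp only: word_eval_append words_append words_Cons words_Nil)
next
  case (relation u w l r)
  then show ?case using k rel by (simp add: word_eval_append)
qed auto

text \<open>The universal property of a presentation: evaluation of words is constant on classes, so
  \<open>the_elem\<close> of the image of a class is its common value.\<close>

lemma presented_group_hom:
  assumes k: "k \<in> S \<rightarrow> carrier G"
    and rel: "\<And>l r. (l, r) \<in> R \<Longrightarrow> l \<in> words S \<Longrightarrow> r \<in> words S \<Longrightarrow> word_eval G k l = word_eval G k r"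
  shows "\<exists>h\<in>hom (presented_group S R) G. \<forall>s\<in>S. h (word_class S R [(s, True)]) = k s"
proof
  let ?h = "\<lambda>A. the_elem (word_eval G k ` A)"
  have h: "?h (word_class S R w) = word_eval G k w" if w: "w \<in> words S" for w
  proof -
    have "word_eval G k ` word_class S R w = {word_eval G k w}"
      using word_eval_word_eq[OF k rel] word_eq.refl[OF w] by (fastforce simp: word_class_def)
    then show ?thesis by simp
  qed
  show "?h \<in> hom (presented_group S R) G"
    using k by (auto intro!: homI simp: carrier_presented_group mult_presented_group h word_eval_append)
  show "\<forall>s\<in>S. ?h (word_class S R [(s, True)]) = k s"
    using k by (auto simp: h Pi_iff)
qed

end

lemma presented_group_hom_eq:
  assumes "group P" "h \<in> hom (presented_group S R) P" "h' \<in> hom (presented_group S R) P"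
    and gens: "\<And>s. s \<in> S \<Longrightarrow> h (word_class S R [(s, True)]) = h' (word_class S R [(s, True)])"
    and "x \<in> carrier (presented_group S R)"
  shows "h x = h' x"
proof -
  let ?G = "presented_group S R"
  let ?c = "word_class S R"
  interpret h: group_hom ?G P h
    using assms by (simp add: group_hom_def group_hom_axioms_def group_presented_group)
  interpret h': group_hom ?G P h'
    using assms by (simp add: group_hom_def group_hom_axioms_def group_presented_group)
  have mem: "?c w \<in> carrier ?G" if "w \<in> words S" for w
    using that by (auto simp: carrier_presented_group)
  have inv: "?c [(s, False)] = inv\<^bsub>?G\<^esub> ?c [(s, True)]" if s: "s \<in> S" for s
  proof (rule h.G.inv_equality[symmetric])
    have "word_eq S R [(s, False), (s, True)] []"
      using word_eq.cancel[of "[]" S "[]" s R False] s by simp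
    then show "?c [(s, False)] \<otimes>\<^bsub>?G\<^esub> ?c [(s, True)] = \<one>\<^bsub>?G\<^esub>"
      using s by (simp add: mult_presented_group one_presented_group word_class_eq_iff)
  qed (use s mem in auto)
  have letter: "h (?c [(s, b)]) = h' (?c [(s, b)])" if s: "s \<in> S" for s b
    using gens[OF s] inv[OF s] mem[of "[(s, True)]"] s by (cases b) auto
  have "h (?c w) = h' (?c w)" if "w \<in> words S" for w
    using that
  proof (induction w)
    case Nil
    then show ?case using h.hom_one h'.hom_one by (simp add: one_presented_group)
  next
    case (Cons x w)
    obtain s b where x: "x = (s, b)" by (cases x)
    then have w: "s \<in> S" "w \<in> words S" using Cons.prems by auto
    have "?c (x # w) = ?c [(s, b)] \<otimes>\<^bsub>?G\<^esub> ?c w"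
      using w x by (simp add: mult_presented_group)
    then show ?case using w Cons.IH letter mem[of "[(s, b)]"] mem[of w] by simp
  qed
  then show ?thesis using assms(5) by (auto simp: carrier_presented_group)
qed

definition raag_gen :: "('a, 'b) pre_digraph \<Rightarrow> 'a \<Rightarrow> 'a word set" where
  "raag_gen \<Gamma> v = word_class (verts \<Gamma>)
    {([(v, True), (w, True)], [(w, True), (v, True)]) | v w. (v, w) \<in> arcs_ends \<Gamma>} [(v, True)]"

lemma raag_gen_closed: "v \<in> verts \<Gamma> \<Longrightarrow> raag_gen \<Gamma> v \<in> carrier (raag \<Gamma>)"
  by (auto simp: raag_gen_def raag_def carrier_presented_group)

lemma raag_gen_commute:
  assumes "wf_digraph \<Gamma>" "(v, w) \<in> arcs_ends \<Gamma>"
  shows "raag_gen \<Gamma> v \<otimes>\<^bsub>raag \<Gamma>\<^esub> raag_gen \<Gamma> w = raag_gen \<Gamma> w \<otimes>\<^bsub>raag \<Gamma>\<^esub> raag_gen \<Gamma> v"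
proof -
  have vw: "v \<in> verts \<Gamma>" "w \<in> verts \<Gamma>"
    using assms by (auto simp: arcs_ends_conv wf_digraph.wellformed)
  let ?R = "{([(v, True), (w, True)], [(w, True), (v, True)]) | v w. (v, w) \<in> arcs_ends \<Gamma>}"
  have "word_eq (verts \<Gamma>) ?R ([] @ [(v, True), (w, True)] @ []) ([] @ [(w, True), (v, True)] @ [])"
    using vw assms(2) by (intro word_eq.relation) auto
  then show ?thesis
    using vw by (simp add: raag_def raag_gen_def mult_presented_group word_class_eq_iff)
qed

lemma raag_hom:
  assumes "group P" "\<And>v. v \<in> verts \<Gamma> \<Longrightarrow> k v \<in> carrier P"
    and "\<And>v w. (v, w) \<in> arcs_ends \<Gamma> \<Longrightarrow> k v \<otimes>\<^bsub>P\<^esub> k w = k w \<otimes>\<^bsub>P\<^esub> k v"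
  shows "\<exists>h\<in>hom (raag \<Gamma>) P. \<forall>v\<in>verts \<Gamma>. h (raag_gen \<Gamma> v) = k v"
proof -
  interpret P: group P by fact
  show ?thesis
    unfolding raag_def raag_gen_def
    using assms(2,3) by (intro P.presented_group_hom) auto
qed

lemma raag_hom_eq:
  assumes "group P" "h \<in> hom (raag \<Gamma>) P" "h' \<in> hom (raag \<Gamma>) P"
    and "\<And>v. v \<in> verts \<Gamma> \<Longrightarrow> h (raag_gen \<Gamma> v) = h' (raag_gen \<Gamma> v)"
    and "x \<in> carrier (raag \<Gamma>)"
  shows "h x = h' x"
  using assms(2-5) unfolding raag_def raag_gen_def by (rule presented_group_hom_eq[OF assms(1)])

section \<open>The Heisenberg group mod \<open>p\<close>\<close>

text \<open>Upper unitriangular 3 by 3 matrices mod \<open>p\<close>, with \<open>a\<close> and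
  \<open>b\<close> next to the diagonal and \<open>c\<close> in the corner. The cocycle
  \<open>a * b'\<close> is the cup product of the first two coordinates.\<close>

definition heisenberg_mod :: "nat \<Rightarrow> (int \<times> int \<times> int) monoid" where
  "heisenberg_mod p = \<lparr>carrier = {0..<int p} \<times> {0..<int p} \<times> {0..<int p},
    monoid.mult = (\<lambda>(a, b, c) (a', b', c').
      ((a + a') mod int p, (b + b') mod int p, (c + c' + a * b') mod int p)),
    one = (0, 0, 0)\<rparr>"

lemma group_heisenberg_mod:
  assumes "p > 0"
  shows "group (heisenberg_mod p)"
proof (rule groupI)
  fix x y z :: "int \<times> int \<times> int"
  obtain a b c a' b' c' a'' b'' c'' where xyz: "x = (a, b, c)" "y = (a', b', c')" "z = (a'', b'', c'')"
    by (metis prod_cases3)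
  have "[(c + c' + a * b') mod int p + c'' + (a + a') mod int p * b'' =
      (c + c' + a * b') + c'' + (a + a') * b''] (mod int p)"
    by (intro cong_add cong_mult) (auto simp: cong_def)
  also have "(c + c' + a * b') + c'' + (a + a') * b'' = c + (c' + c'' + a' * b'') + a * (b' + b'')"
    by (simp add: algebra_simps)
  also have "[\<dots> = c + (c' + c'' + a' * b'') mod int p + a * ((b' + b'') mod int p)] (mod int p)"
    by (intro cong_add cong_mult) (auto simp: cong_def)
  finally show "x \<otimes>\<^bsub>heisenberg_mod p\<^esub> y \<otimes>\<^bsub>heisenberg_mod p\<^esub> z =
      x \<otimes>\<^bsub>heisenberg_mod p\<^esub> (y \<otimes>\<^bsub>heisenberg_mod p\<^esub> z)"
    by (simp add: heisenberg_mod_def xyz cong_def mod_simps add.assoc)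
next
  fix x assume "x \<in> carrier (heisenberg_mod p)"
  then obtain a b c where x: "x = (a, b, c)" by (cases x)
  have "[(a * b - c) mod int p + c + (- a) mod int p * b = (a * b - c) + c + (- a) * b] (mod int p)"
    by (intro cong_add cong_mult) (auto simp: cong_def)
  then have "((- a) mod int p, (- b) mod int p, (a * b - c) mod int p) \<otimes>\<^bsub>heisenberg_mod p\<^esub> x =
      \<one>\<^bsub>heisenberg_mod p\<^esub>"
    by (simp add: heisenberg_mod_def x mod_simps cong_def)
  then show "\<exists>y\<in>carrier (heisenberg_mod p). y \<otimes>\<^bsub>heisenberg_mod p\<^esub> x = \<one>\<^bsub>heisenberg_mod p\<^esub>"
    by (rule bexI) (use assms in \<open>auto simp: heisenberg_mod_def\<close>)
qed (use assms in \<open>auto simp: heisenberg_mod_def\<close>)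

lemma card_heisenberg_mod: "card (carrier (heisenberg_mod p)) = p ^ 3"
  by (simp add: heisenberg_mod_def card_cartesian_product power3_eq_cube)

lemma heisenberg_mod_coordinates:
  assumes "p > 0"
  shows "fst \<in> hom (heisenberg_mod p) (integer_mod_group p)"
    and "(\<lambda>x. fst (snd x)) \<in> hom (heisenberg_mod p) (integer_mod_group p)"
  using assms by (auto simp: hom_def heisenberg_mod_def carrier_integer_mod_group)

text \<open>The two products can differ only in the corner, by \<open>a * b' - a' * b\<close>. This
  links commuting generators with \<open>perp\<close>.\<close>

lemma heisenberg_mod_commute_iff:
  "(a, b, c) \<otimes>\<^bsub>heisenberg_mod p\<^esub> (a', b', c') = (a', b', c') \<otimes>\<^bsub>heisenberg_mod p\<^esub> (a, b, c)
    \<longleftrightarrow> [a * b' = a' * b] (mod int p)"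
proof -
  have "[c + c' + a * b' = c' + c + a' * b] (mod int p) \<longleftrightarrow> [a * b' = a' * b] (mod int p)"
    by (simp add: cong_iff_dvd_diff add.commute)
  then show ?thesis by (simp add: heisenberg_mod_def cong_def add.commute)
qed

section \<open>Isomorphisms of completions and of graphs\<close>

text \<open>Without multiple arcs an arc is determined by its ends, so the arc map that
  \<open>digraph_iso\<close> requires can be reconstructed from the vertex map.\<close>

lemma digraph_iso_iff_bij_arcs_ends:
  fixes \<Gamma> :: "('a, 'b) pre_digraph" and \<Gamma>' :: "('c, 'd) pre_digraph"
  assumes "nomulti_digraph \<Gamma>" "nomulti_digraph \<Gamma>'"
  shows "digraph_iso \<Gamma> \<Gamma>' \<longleftrightarrow> (\<exists>\<sigma>. bij_betw \<sigma> (verts \<Gamma>) (verts \<Gamma>') \<and>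
    (\<forall>v\<in>verts \<Gamma>. \<forall>w\<in>verts \<Gamma>. (v, w) \<in> arcs_ends \<Gamma> \<longleftrightarrow> (\<sigma> v, \<sigma> w) \<in> arcs_ends \<Gamma>'))"
    (is "?L \<longleftrightarrow> (\<exists>\<sigma>. ?R \<sigma>)")
proof
  interpret G: nomulti_digraph \<Gamma> by fact
  assume ?L
  then obtain f where f: "G.digraph_isomorphism f" "\<Gamma>' = app_iso f \<Gamma>"
    by (auto simp: digraph_iso_def)
  have inj: "inj_on (iso_verts f) (verts \<Gamma>)" using f(1) by (simp add: G.digraph_isomorphism_def)
  have "(v, w) \<in> arcs_ends \<Gamma> \<longleftrightarrow> (iso_verts f v, iso_verts f w) \<in> arcs_ends \<Gamma>'"
    if "v \<in> verts \<Gamma>" "w \<in> verts \<Gamma>" for v w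
  proof -
    have "(iso_verts f v, iso_verts f w) \<in> arcs_ends \<Gamma>' \<longleftrightarrow>
        (\<exists>e\<in>arcs \<Gamma>. iso_verts f v = iso_verts f (tail \<Gamma> e) \<and> iso_verts f w = iso_verts f (head \<Gamma> e))"
      using f(1) by (auto simp: f(2) arcs_ends_conv image_iff G.iso_verts_tail G.iso_verts_head)
    also have "\<dots> \<longleftrightarrow> (v, w) \<in> arcs_ends \<Gamma>"
      using that by (auto simp: arcs_ends_conv image_iff G.iso_verts_eq_iff[OF f(1)])
    finally show ?thesis by simp
  qed
  then show "\<exists>\<sigma>. ?R \<sigma>" using inj f(2) by (intro exI[of _ "iso_verts f"]) (auto simp: bij_betw_def)
next
  interpret G: nomulti_digraph \<Gamma> by fact
  interpret H: nomulti_digraph \<Gamma>' by fact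
  assume "\<exists>\<sigma>. ?R \<sigma>"
  then obtain \<sigma> where \<sigma>: "bij_betw \<sigma> (verts \<Gamma>) (verts \<Gamma>')"
    "\<And>v w. v \<in> verts \<Gamma> \<Longrightarrow> w \<in> verts \<Gamma> \<Longrightarrow> (v, w) \<in> arcs_ends \<Gamma> \<longleftrightarrow> (\<sigma> v, \<sigma> w) \<in> arcs_ends \<Gamma>'"
    by blast
  have bij: "bij_betw (arc_to_ends \<Gamma>) (arcs \<Gamma>) (arcs_ends \<Gamma>)"
    and bij': "bij_betw (arc_to_ends \<Gamma>') (arcs \<Gamma>') (arcs_ends \<Gamma>')"
    using G.no_multi_arcs H.no_multi_arcs
    by (auto simp: bij_betw_def arcs_ends_def arc_to_ends_def intro!: inj_onI)
  have sub: "arcs_ends \<Gamma> \<subseteq> verts \<Gamma> \<times> verts \<Gamma>" "arcs_ends \<Gamma>' \<subseteq> verts \<Gamma>' \<times> verts \<Gamma>'"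
    by (auto simp: arcs_ends_conv)
  have img: "map_prod \<sigma> \<sigma> ` arcs_ends \<Gamma> = arcs_ends \<Gamma>'"
  proof (intro equalityI subsetI)
    fix e assume "e \<in> map_prod \<sigma> \<sigma> ` arcs_ends \<Gamma>"
    then show "e \<in> arcs_ends \<Gamma>'" using \<sigma>(2) sub(1) by force
  next
    fix e assume e: "e \<in> arcs_ends \<Gamma>'"
    then have "e \<in> \<sigma> ` verts \<Gamma> \<times> \<sigma> ` verts \<Gamma>" using sub(2) \<sigma>(1) by (auto simp: bij_betw_def)
    then show "e \<in> map_prod \<sigma> \<sigma> ` arcs_ends \<Gamma>" using e \<sigma>(2) by force
  qed
  have "inj_on (map_prod \<sigma> \<sigma>) (arcs_ends \<Gamma>)"
    using \<sigma>(1) by (intro inj_on_subset[OF map_prod_inj_on sub(1)]) (auto simp: bij_betw_def)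
  with img have "bij_betw (map_prod \<sigma> \<sigma>) (arcs_ends \<Gamma>) (arcs_ends \<Gamma>')" by (simp add: bij_betw_def)
  \<comment> \<open>Sends an arc to the unique arc of \<open>\<Gamma>'\<close> that joins the images
    of its ends.\<close>
  define \<alpha> where "\<alpha> = inv_into (arcs \<Gamma>') (arc_to_ends \<Gamma>') \<circ> (map_prod \<sigma> \<sigma> \<circ> arc_to_ends \<Gamma>)"
  have \<alpha>: "bij_betw \<alpha> (arcs \<Gamma>) (arcs \<Gamma>')"
    unfolding \<alpha>_def
    using bij \<open>bij_betw (map_prod \<sigma> \<sigma>) _ _\<close> bij_betw_inv_into[OF bij'] by (intro bij_betw_trans)
  have ends: "arc_to_ends \<Gamma>' (\<alpha> e) = map_prod \<sigma> \<sigma> (arc_to_ends \<Gamma> e)" if e: "e \<in> arcs \<Gamma>" for e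
  proof -
    have "arc_to_ends \<Gamma> e \<in> arcs_ends \<Gamma>" using bij_betw_apply[OF bij e] .
    then have "map_prod \<sigma> \<sigma> (arc_to_ends \<Gamma> e) \<in> arcs_ends \<Gamma>'" using img by blast
    then show ?thesis using bij_betw_inv_into_right[OF bij'] by (simp add: \<alpha>_def)
  qed
  \<comment> \<open>\<open>digraph_iso\<close> asks that the relabelled digraph be equal to
    \<open>\<Gamma>'\<close>, hence the end functions of \<open>\<Gamma>'\<close>
    themselves.\<close>
  define f where "f = \<lparr>iso_verts = \<sigma>, iso_arcs = \<alpha>, iso_head = head \<Gamma>', iso_tail = tail \<Gamma>'\<rparr>"
  have "G.digraph_isomorphism f"
    unfolding G.digraph_isomorphism_def
    using \<sigma>(1) \<alpha> ends G.wf_digraph_axioms by (auto simp: f_def bij_betw_def arc_to_ends_def)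
  moreover have "\<Gamma>' = app_iso f \<Gamma>"
    using \<sigma>(1) \<alpha> by (auto simp: app_iso_def f_def bij_betw_def)
  ultimately show ?L by (auto simp: digraph_iso_def)
qed

section \<open>From graph isomorphisms to completions\<close>

lemma raag_hom_of_graph_hom:
  assumes "wf_digraph \<Gamma>'" "\<And>v. v \<in> verts \<Gamma> \<Longrightarrow> \<sigma> v \<in> verts \<Gamma>'"
    and "\<And>v w. (v, w) \<in> arcs_ends \<Gamma> \<Longrightarrow> (\<sigma> v, \<sigma> w) \<in> arcs_ends \<Gamma>'"
  shows "\<exists>\<theta>\<in>hom (raag \<Gamma>) (raag \<Gamma>'). \<forall>v\<in>verts \<Gamma>. \<theta> (raag_gen \<Gamma> v) = raag_gen \<Gamma>' (\<sigma> v)"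
  using assms by (intro raag_hom group_raag raag_gen_closed raag_gen_commute)

lemma raag_hom_inverse:
  assumes "\<theta> \<in> hom (raag \<Gamma>) (raag \<Gamma>')" "\<eta> \<in> hom (raag \<Gamma>') (raag \<Gamma>)"
    and "\<And>v. v \<in> verts \<Gamma> \<Longrightarrow> \<eta> (\<theta> (raag_gen \<Gamma> v)) = raag_gen \<Gamma> v"
    and "x \<in> carrier (raag \<Gamma>)"
  shows "\<eta> (\<theta> x) = x"
proof -
  have "id \<in> hom (raag \<Gamma>) (raag \<Gamma>)" by (simp add: hom_def)
  from raag_hom_eq[OF group_raag hom_compose[OF assms(1,2)] this _ assms(4)]
  have "(\<eta> \<circ> \<theta>) x = id x" using assms(3) by simp
  then show ?thesis by simp
qed

lemma pro_p_completions_isomorphic_if_digraph_iso: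
  assumes "graph \<Gamma>" "graph \<Gamma>'" "prime p" "digraph_iso \<Gamma> \<Gamma>'"
  shows "topological_groups_isomorphic
    (pro_p_completion p (raag \<Gamma>)) (pro_p_topology p (raag \<Gamma>))
    (pro_p_completion p (raag \<Gamma>')) (pro_p_topology p (raag \<Gamma>'))"
proof -
  interpret G: graph \<Gamma> by fact
  interpret H: graph \<Gamma>' by fact
  obtain \<sigma> where \<sigma>: "bij_betw \<sigma> (verts \<Gamma>) (verts \<Gamma>')"
    "\<And>v w. v \<in> verts \<Gamma> \<Longrightarrow> w \<in> verts \<Gamma> \<Longrightarrow> (v, w) \<in> arcs_ends \<Gamma> \<longleftrightarrow> (\<sigma> v, \<sigma> w) \<in> arcs_ends \<Gamma>'"
    using assms(4) digraph_iso_iff_bij_arcs_ends[OF G.nomulti_digraph_axioms H.nomulti_digraph_axioms]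
    by blast
  define \<tau> where "\<tau> = inv_into (verts \<Gamma>) \<sigma>"
  have \<tau>: "\<And>u. u \<in> verts \<Gamma>' \<Longrightarrow> \<tau> u \<in> verts \<Gamma>" "\<And>u. u \<in> verts \<Gamma>' \<Longrightarrow> \<sigma> (\<tau> u) = u"
    "\<And>v. v \<in> verts \<Gamma> \<Longrightarrow> \<tau> (\<sigma> v) = v" "\<And>v. v \<in> verts \<Gamma> \<Longrightarrow> \<sigma> v \<in> verts \<Gamma>'"
    using \<sigma>(1) bij_betwE[OF bij_betw_inv_into[OF \<sigma>(1)]] unfolding \<tau>_def
    by (auto simp: bij_betw_inv_into_left bij_betw_inv_into_right bij_betwE)
  have sub: "v \<in> verts \<Gamma>" "w \<in> verts \<Gamma>" if "(v, w) \<in> arcs_ends \<Gamma>" for v w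
    using that by (auto simp: arcs_ends_conv)
  have sub': "v \<in> verts \<Gamma>'" "w \<in> verts \<Gamma>'" if "(v, w) \<in> arcs_ends \<Gamma>'" for v w
    using that by (auto simp: arcs_ends_conv)
  have \<sigma>_hom: "(\<sigma> v, \<sigma> w) \<in> arcs_ends \<Gamma>'" if "(v, w) \<in> arcs_ends \<Gamma>" for v w
    using \<sigma>(2)[OF sub[OF that]] that by simp
  have \<tau>_hom: "(\<tau> v, \<tau> w) \<in> arcs_ends \<Gamma>" if "(v, w) \<in> arcs_ends \<Gamma>'" for v w
    using \<sigma>(2)[of "\<tau> v" "\<tau> w"] \<tau>(1,2) sub'[OF that] that by simp
  obtain \<theta> where \<theta>: "\<theta> \<in> hom (raag \<Gamma>) (raag \<Gamma>')"
    "\<And>v. v \<in> verts \<Gamma> \<Longrightarrow> \<theta> (raag_gen \<Gamma> v) = raag_gen \<Gamma>' (\<sigma> v)"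
    using raag_hom_of_graph_hom[where \<sigma> = \<sigma> and \<Gamma> = \<Gamma>, OF H.wf_digraph_axioms \<tau>(4) \<sigma>_hom] by blast
  obtain \<eta> where \<eta>: "\<eta> \<in> hom (raag \<Gamma>') (raag \<Gamma>)"
    "\<And>v. v \<in> verts \<Gamma>' \<Longrightarrow> \<eta> (raag_gen \<Gamma>' v) = raag_gen \<Gamma> (\<tau> v)"
    using raag_hom_of_graph_hom[where \<sigma> = \<tau> and \<Gamma> = \<Gamma>', OF G.wf_digraph_axioms \<tau>(1) \<tau>_hom] by blast
  have "\<eta> (\<theta> g) = g" if "g \<in> carrier (raag \<Gamma>)" for g
    by (rule raag_hom_inverse[OF \<theta>(1) \<eta>(1) _ that]) (simp add: \<theta>(2) \<eta>(2) \<tau>)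
  moreover have "\<theta> (\<eta> g) = g" if "g \<in> carrier (raag \<Gamma>')" for g
    by (rule raag_hom_inverse[OF \<eta>(1) \<theta>(1) _ that]) (simp add: \<theta>(2) \<eta>(2) \<tau>)
  ultimately show ?thesis
    using pro_p_completions_isomorphic[OF assms(3) group_raag group_raag \<theta>(1) \<eta>(1)] by blast
qed

section \<open>Continuous homomorphisms from the completion of a right-angled Artin group\<close>

abbreviation pro_p_gen :: "nat \<Rightarrow> ('a, 'b) pre_digraph \<Rightarrow> 'a \<Rightarrow> 'a word set set \<Rightarrow> 'a word set set" where
  "pro_p_gen p \<Gamma> v \<equiv> pro_p_embed p (raag \<Gamma>) (raag_gen \<Gamma> v)"

lemma pro_p_gen_closed: "v \<in> verts \<Gamma> \<Longrightarrow> pro_p_gen p \<Gamma> v \<in> carrier (pro_p_completion p (raag \<Gamma>))"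
  by (intro pro_p_embed_closed group_raag raag_gen_closed)

text \<open>The generators determine the map on the group, whose image in the completion is
  dense.\<close>

lemma cont_homs_raag_eqI:
  assumes "prime p" "group P" and h: "h \<in> cont_homs p (raag \<Gamma>) P" "h' \<in> cont_homs p (raag \<Gamma>) P"
    and gens: "\<And>v. v \<in> verts \<Gamma> \<Longrightarrow> h (pro_p_gen p \<Gamma> v) = h' (pro_p_gen p \<Gamma> v)"
    and x: "x \<in> carrier (pro_p_completion p (raag \<Gamma>))"
  shows "h x = h' x"
proof (rule cont_homs_eqI[OF assms(1) group_raag assms(2) h _ x])
  fix g assume g: "g \<in> carrier (raag \<Gamma>)"
  have "k \<circ> pro_p_embed p (raag \<Gamma>) \<in> hom (raag \<Gamma>) P" if "k \<in> cont_homs p (raag \<Gamma>) P" for k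
    using that pro_p_embed_hom[OF group_raag] by (intro hom_compose) (auto simp: cont_homs_def)
  from raag_hom_eq[OF assms(2) this[OF h(1)] this[OF h(2)] _ g]
  have "(h \<circ> pro_p_embed p (raag \<Gamma>)) g = (h' \<circ> pro_p_embed p (raag \<Gamma>)) g"
    using gens by simp
  then show "h (pro_p_embed p (raag \<Gamma>) g) = h' (pro_p_embed p (raag \<Gamma>) g)" by simp
qed

text \<open>Combines the universal properties of the presentation and of the completion, the latter
  for finite \<open>p\<close>-groups.\<close>

lemma cont_homs_raag_exists:
  assumes "prime p" "group P" "card (carrier P) = p ^ n" "\<And>v. v \<in> verts \<Gamma> \<Longrightarrow> k v \<in> carrier P"
    and "\<And>v w. (v, w) \<in> arcs_ends \<Gamma> \<Longrightarrow> k v \<otimes>\<^bsub>P\<^esub> k w = k w \<otimes>\<^bsub>P\<^esub> k v"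
  shows "\<exists>h\<in>cont_homs p (raag \<Gamma>) P. \<forall>v\<in>verts \<Gamma>. h (pro_p_gen p \<Gamma> v) = k v"
proof -
  obtain h\<^sub>0 where h\<^sub>0: "h\<^sub>0 \<in> hom (raag \<Gamma>) P" "\<And>v. v \<in> verts \<Gamma> \<Longrightarrow> h\<^sub>0 (raag_gen \<Gamma> v) = k v"
    using raag_hom[where k = k, OF assms(2,4,5)] by blast
  obtain h where "h \<in> cont_homs p (raag \<Gamma>) P"
    "\<And>g. g \<in> carrier (raag \<Gamma>) \<Longrightarrow> h (pro_p_embed p (raag \<Gamma>) g) = h\<^sub>0 g"
    using cont_homs_extend[OF assms(1) group_raag assms(2) h\<^sub>0(1) assms(3)] by blast
  then show ?thesis using h\<^sub>0(2) raag_gen_closed by metis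
qed

text \<open>The functional with coordinates \<open>a\<close>, which identifies F_p^V with the
  continuous homomorphisms to Z/p. It is unique only on the completion, so later equalities are
  pointwise there.\<close>

definition lift_vec ::
  "nat \<Rightarrow> ('a, 'b) pre_digraph \<Rightarrow> ('a \<Rightarrow> int) \<Rightarrow> ('a word set set \<Rightarrow> 'a word set set) \<Rightarrow> int" where
  "lift_vec p \<Gamma> a = (SOME h. h \<in> cont_homs p (raag \<Gamma>) (integer_mod_group p) \<and>
    (\<forall>v\<in>verts \<Gamma>. h (pro_p_gen p \<Gamma> v) = a v mod int p))"

lemma lift_vec:
  assumes "prime p"
  shows "lift_vec p \<Gamma> a \<in> cont_homs p (raag \<Gamma>) (integer_mod_group p)"
    and "v \<in> verts \<Gamma> \<Longrightarrow> lift_vec p \<Gamma> a (pro_p_gen p \<Gamma> v) = a v mod int p"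
proof -
  have p: "p > 0" using assms prime_gt_0_nat by blast
  have "\<exists>h\<in>cont_homs p (raag \<Gamma>) (integer_mod_group p).
      \<forall>v\<in>verts \<Gamma>. h (pro_p_gen p \<Gamma> v) = a v mod int p"
    using assms p
    by (intro cont_homs_raag_exists[where n = 1 and k = "\<lambda>v. a v mod int p"]) (auto simp: carrier_integer_mod_group add.commute)
  then show "lift_vec p \<Gamma> a \<in> cont_homs p (raag \<Gamma>) (integer_mod_group p)"
    "v \<in> verts \<Gamma> \<Longrightarrow> lift_vec p \<Gamma> a (pro_p_gen p \<Gamma> v) = a v mod int p"
    using someI_ex[of "\<lambda>h. h \<in> cont_homs p (raag \<Gamma>) (integer_mod_group p) \<and>
      (\<forall>v\<in>verts \<Gamma>. h (pro_p_gen p \<Gamma> v) = a v mod int p)"]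
    unfolding lift_vec_def by blast+
qed

lemma lift_vec_unique:
  assumes "prime p" "h \<in> cont_homs p (raag \<Gamma>) (integer_mod_group p)"
    and "\<And>v. v \<in> verts \<Gamma> \<Longrightarrow> h (pro_p_gen p \<Gamma> v) = a v mod int p"
    and "x \<in> carrier (pro_p_completion p (raag \<Gamma>))"
  shows "lift_vec p \<Gamma> a x = h x"
  by (rule cont_homs_raag_eqI[OF assms(1) group_integer_mod_group lift_vec(1)[OF assms(1)] assms(2) _ assms(4)])
    (simp add: lift_vec(2)[OF assms(1)] assms(3))

text \<open>The pair \<open>(a, b)\<close> is lifted at once to a product of two copies of Z/p. All
  three functionals are this one map followed by a homomorphism of finite groups, so uniqueness
  applies.\<close>

lemma lift_vec_lin:
  assumes "prime p" and x: "x \<in> carrier (pro_p_completion p (raag \<Gamma>))"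
  shows "[lift_vec p \<Gamma> (\<lambda>v. a v + c * b v) x = lift_vec p \<Gamma> a x + c * lift_vec p \<Gamma> b x] (mod int p)"
proof -
  have p: "p > 0" using assms prime_gt_0_nat by blast
  let ?Z = "integer_mod_group p"
  let ?P = "?Z \<times>\<times> ?Z"
  have P: "group ?P" by (intro DirProd_group) simp_all
  have card: "card (carrier ?P) = p ^ 2"
    using p by (simp add: card_cartesian_product carrier_integer_mod_group power2_eq_square)
  let ?k = "\<lambda>v. (a v mod int p, b v mod int p)"
  have "\<exists>h\<in>cont_homs p (raag \<Gamma>) ?P. \<forall>v\<in>verts \<Gamma>. h (pro_p_gen p \<Gamma> v) = ?k v"
    using p
    by (intro cont_homs_raag_exists[where k = ?k, OF assms(1) P card])
      (auto simp: carrier_integer_mod_group add.commute)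
  then obtain h where h: "h \<in> cont_homs p (raag \<Gamma>) ?P"
    "\<And>v. v \<in> verts \<Gamma> \<Longrightarrow> h (pro_p_gen p \<Gamma> v) = ?k v"
    by blast
  let ?q = "\<lambda>(x, y). (x + c * y) mod int p"
  have q: "fst \<in> hom ?P ?Z" "snd \<in> hom ?P ?Z"
    by (auto simp: hom_def)
  have q': "?q \<in> hom ?P ?Z"
  proof (rule homI)
    fix z z' :: "int \<times> int"
    obtain x y x' y' where z: "z = (x, y)" "z' = (x', y')" by (metis prod.exhaust)
    have "[(x + x') mod int p + c * ((y + y') mod int p) = (x + x') + c * (y + y')] (mod int p)"
      by (intro cong_add cong_mult) (auto simp: cong_def)
    also have "(x + x') + c * (y + y') = (x + c * y) + (x' + c * y')" by (simp add: algebra_simps)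
    finally show "?q (z \<otimes>\<^bsub>?P\<^esub> z') = ?q z \<otimes>\<^bsub>?Z\<^esub> ?q z'"
      by (simp add: z cong_def mod_simps)
  qed (use p in \<open>auto simp: carrier_integer_mod_group\<close>)
  have "lift_vec p \<Gamma> a x = (fst \<circ> h) x"
    by (rule lift_vec_unique[OF assms(1) cont_homs_comp_hom[OF P group_integer_mod_group h(1) q(1)] _ x])
      (simp add: h(2))
  moreover have "lift_vec p \<Gamma> b x = (snd \<circ> h) x"
    by (rule lift_vec_unique[OF assms(1) cont_homs_comp_hom[OF P group_integer_mod_group h(1) q(2)] _ x])
      (simp add: h(2))
  moreover have "lift_vec p \<Gamma> (\<lambda>v. a v + c * b v) x = (?q \<circ> h) x"
    by (rule lift_vec_unique[OF assms(1) cont_homs_comp_hom[OF P group_integer_mod_group h(1) q'] _ x])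
      (simp add: h(2) mod_simps, metis mod_add_right_eq mod_mult_right_eq)
  ultimately show ?thesis by (simp add: cong_def case_prod_unfold)
qed

text \<open>Orthogonality says that the chosen images of adjacent generators commute. The first two
  coordinates of the lift are identified by uniqueness of \<open>lift_vec\<close>.\<close>

lemma perp_imp_heisenberg_lift:
  assumes "prime p" "perp (arcs_ends \<Gamma>) p a b"
  obtains h where "h \<in> cont_homs p (raag \<Gamma>) (heisenberg_mod p)"
    "\<And>x. x \<in> carrier (pro_p_completion p (raag \<Gamma>)) \<Longrightarrow>
      fst (h x) = lift_vec p \<Gamma> a x \<and> fst (snd (h x)) = lift_vec p \<Gamma> b x"
proof -
  have p: "p > 0" using assms prime_gt_0_nat by blast
  \<comment> \<open>The corner entry 0 is an arbitrary choice, since commutation concerns the first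
    two coordinates.\<close>
  let ?k = "\<lambda>v. (a v mod int p, b v mod int p, 0)"
  have comm: "?k v \<otimes>\<^bsub>heisenberg_mod p\<^esub> ?k w = ?k w \<otimes>\<^bsub>heisenberg_mod p\<^esub> ?k v"
    if "(v, w) \<in> arcs_ends \<Gamma>" for v w
    using that assms(2) unfolding heisenberg_mod_commute_iff
    by (auto simp: perp_def cong_def mod_simps)
  have "?k v \<in> carrier (heisenberg_mod p)" for v using p by (simp add: heisenberg_mod_def)
  then have "\<exists>h\<in>cont_homs p (raag \<Gamma>) (heisenberg_mod p). \<forall>v\<in>verts \<Gamma>. h (pro_p_gen p \<Gamma> v) = ?k v"
    using comm
    by (intro cont_homs_raag_exists[where k = ?k, OF assms(1) group_heisenberg_mod[OF p] card_heisenberg_mod])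
  then obtain h where h: "h \<in> cont_homs p (raag \<Gamma>) (heisenberg_mod p)"
    "\<And>v. v \<in> verts \<Gamma> \<Longrightarrow> h (pro_p_gen p \<Gamma> v) = ?k v"
    by blast
  note coord = heisenberg_mod_coordinates[OF p,
      THEN cont_homs_comp_hom[OF group_heisenberg_mod[OF p] group_integer_mod_group h(1)]]
  have "lift_vec p \<Gamma> a x = (fst \<circ> h) x" "lift_vec p \<Gamma> b x = ((\<lambda>x. fst (snd x)) \<circ> h) x"
    if x: "x \<in> carrier (pro_p_completion p (raag \<Gamma>))" for x
    by (rule lift_vec_unique[OF assms(1) coord(1) _ x], simp add: h(2))
      (rule lift_vec_unique[OF assms(1) coord(2) _ x], simp add: h(2))
  then show thesis using that h(1) by simp
qed

text \<open>Adjacent generators commute, hence so do their images, and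
  \<open>heisenberg_mod_commute_iff\<close> reads this off in coordinates.\<close>

lemma heisenberg_hom_imp_perp:
  assumes "wf_digraph \<Gamma>" and h: "h \<in> cont_homs p (raag \<Gamma>) (heisenberg_mod p)"
  shows "perp (arcs_ends \<Gamma>) p (\<lambda>v. fst (h (pro_p_gen p \<Gamma> v))) (\<lambda>v. fst (snd (h (pro_p_gen p \<Gamma> v))))"
proof -
  let ?h = "h \<circ> pro_p_embed p (raag \<Gamma>)"
  have hom: "?h \<in> hom (raag \<Gamma>) (heisenberg_mod p)"
    using h pro_p_embed_hom[OF group_raag] by (intro hom_compose) (auto simp: cont_homs_def)
  have "[fst (?h (raag_gen \<Gamma> v)) * fst (snd (?h (raag_gen \<Gamma> w))) =
      fst (?h (raag_gen \<Gamma> w)) * fst (snd (?h (raag_gen \<Gamma> v)))] (mod int p)"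
    if vw: "(v, w) \<in> arcs_ends \<Gamma>" for v w
  proof -
    have V: "v \<in> verts \<Gamma>" "w \<in> verts \<Gamma>"
      using vw assms(1) by (auto simp: arcs_ends_conv wf_digraph.wellformed)
    have "?h (raag_gen \<Gamma> v) \<otimes>\<^bsub>heisenberg_mod p\<^esub> ?h (raag_gen \<Gamma> w) =
        ?h (raag_gen \<Gamma> w) \<otimes>\<^bsub>heisenberg_mod p\<^esub> ?h (raag_gen \<Gamma> v)"
      using V raag_gen_closed hom_mult[OF hom] raag_gen_commute[OF assms(1) vw] by metis
    then show ?thesis
      using heisenberg_mod_commute_iff by (metis prod.collapse)
  qed
  then show ?thesis by (auto simp: perp_def)
qed

section \<open>Linear maps induced by continuous homomorphisms\<close>

text \<open>Pullback of functionals along \<open>f\<close>, in coordinates. It is contravariant: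
  \<open>f\<close> runs from the completion for \<open>\<Gamma>'\<close> to that for
  \<open>\<Gamma>\<close>, vectors pass from \<open>\<Gamma>\<close> to
  \<open>\<Gamma>'\<close>.\<close>

definition transfer_vec ::
  "nat \<Rightarrow> ('a, 'b) pre_digraph \<Rightarrow> ('c, 'd) pre_digraph \<Rightarrow>
    (('c word set set \<Rightarrow> 'c word set set) \<Rightarrow> ('a word set set \<Rightarrow> 'a word set set)) \<Rightarrow>
    ('a \<Rightarrow> int) \<Rightarrow> 'c \<Rightarrow> int" where
  "transfer_vec p \<Gamma> \<Gamma>' f a u = lift_vec p \<Gamma> a (f (pro_p_gen p \<Gamma>' u))"

locale pro_p_raag_hom =
  fixes p :: nat and \<Gamma> :: "('a, 'b) pre_digraph" and \<Gamma>' :: "('c, 'd) pre_digraph"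
    and f :: "('c word set set \<Rightarrow> 'c word set set) \<Rightarrow> 'a word set set \<Rightarrow> 'a word set set"
  assumes prime: "prime p" and wf: "wf_digraph \<Gamma>" and wf': "wf_digraph \<Gamma>'"
    and hom: "f \<in> hom (pro_p_completion p (raag \<Gamma>')) (pro_p_completion p (raag \<Gamma>))"
    and cont: "continuous_map (pro_p_topology p (raag \<Gamma>')) (pro_p_topology p (raag \<Gamma>)) f"
begin

lemma closed: "u \<in> verts \<Gamma>' \<Longrightarrow> f (pro_p_gen p \<Gamma>' u) \<in> carrier (pro_p_completion p (raag \<Gamma>))"
  using hom pro_p_gen_closed by (rule hom_in_carrier)

lemma transfer_lin:
  "u \<in> verts \<Gamma>' \<Longrightarrow> [transfer_vec p \<Gamma> \<Gamma>' f (\<lambda>v. a v + c * b v) u =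
    transfer_vec p \<Gamma> \<Gamma>' f a u + c * transfer_vec p \<Gamma> \<Gamma>' f b u] (mod int p)"
  unfolding transfer_vec_def by (intro lift_vec_lin prime closed)

lemma transfer_cong:
  assumes "\<And>v. v \<in> verts \<Gamma> \<Longrightarrow> [a v = b v] (mod int p)" "u \<in> verts \<Gamma>'"
  shows "[transfer_vec p \<Gamma> \<Gamma>' f a u = transfer_vec p \<Gamma> \<Gamma>' f b u] (mod int p)"
proof -
  have "lift_vec p \<Gamma> a (f (pro_p_gen p \<Gamma>' u)) = lift_vec p \<Gamma> b (f (pro_p_gen p \<Gamma>' u))"
    by (rule lift_vec_unique[OF prime lift_vec(1)[OF prime] _ closed[OF assms(2)]])
      (use assms(1) in \<open>simp add: lift_vec(2)[OF prime] cong_def\<close>)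
  then show ?thesis by (simp add: transfer_vec_def)
qed

text \<open>A Heisenberg lift of \<open>(a, b)\<close>, composed with \<open>f\<close>, is a
  Heisenberg lift of the transferred pair.\<close>

lemma transfer_perp:
  assumes "perp (arcs_ends \<Gamma>) p a b"
  shows "perp (arcs_ends \<Gamma>') p (transfer_vec p \<Gamma> \<Gamma>' f a) (transfer_vec p \<Gamma> \<Gamma>' f b)"
proof -
  obtain h where h: "h \<in> cont_homs p (raag \<Gamma>) (heisenberg_mod p)"
    "\<And>x. x \<in> carrier (pro_p_completion p (raag \<Gamma>)) \<Longrightarrow>
      fst (h x) = lift_vec p \<Gamma> a x \<and> fst (snd (h x)) = lift_vec p \<Gamma> b x"
    using perp_imp_heisenberg_lift[OF prime assms] by blast
  have "h \<circ> f \<in> cont_homs p (raag \<Gamma>') (heisenberg_mod p)"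
    using prime group_raag group_raag h(1) hom cont by (rule cont_homs_comp_continuous)
  from heisenberg_hom_imp_perp[OF wf' this]
  have perp: "perp (arcs_ends \<Gamma>') p (\<lambda>u. fst (h (f (pro_p_gen p \<Gamma>' u))))
      (\<lambda>u. fst (snd (h (f (pro_p_gen p \<Gamma>' u)))))" by simp
  have "v \<in> verts \<Gamma>' \<and> w \<in> verts \<Gamma>'" if "(v, w) \<in> arcs_ends \<Gamma>'" for v w
    using that wf' by (auto simp: arcs_ends_conv wf_digraph.wellformed)
  then show ?thesis
    using perp h(2)[OF closed] unfolding perp_def transfer_vec_def by fastforce
qed

text \<open>The transferred vector represents the composite with \<open>f\<close>, so transfers
  along inverse maps are inverse to each other.\<close>

lemma lift_transfer:
  assumes x: "x \<in> carrier (pro_p_completion p (raag \<Gamma>'))"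
  shows "lift_vec p \<Gamma>' (transfer_vec p \<Gamma> \<Gamma>' f a) x = lift_vec p \<Gamma> a (f x)"
proof -
  have l: "lift_vec p \<Gamma> a \<in> cont_homs p (raag \<Gamma>) (integer_mod_group p)"
    using prime by (rule lift_vec)
  have lf: "lift_vec p \<Gamma> a \<circ> f \<in> cont_homs p (raag \<Gamma>') (integer_mod_group p)"
    using prime group_raag group_raag l hom cont by (rule cont_homs_comp_continuous)
  \<comment> \<open>\<open>lift_vec_unique\<close> compares with reduced values, so the values must
    be known to be residues.\<close>
  have range: "lift_vec p \<Gamma> a y mod int p = lift_vec p \<Gamma> a y"
    if "y \<in> carrier (pro_p_completion p (raag \<Gamma>))" for y
  proof -
    have "lift_vec p \<Gamma> a y \<in> carrier (integer_mod_group p)"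
      using l that by (auto simp: cont_homs_def hom_def)
    then show ?thesis using prime prime_gt_0_nat[of p] by (simp add: carrier_integer_mod_group)
  qed
  have "lift_vec p \<Gamma>' (transfer_vec p \<Gamma> \<Gamma>' f a) x = (lift_vec p \<Gamma> a \<circ> f) x"
    by (rule lift_vec_unique[OF prime lf _ x]) (simp add: transfer_vec_def range[OF closed])
  then show ?thesis by simp
qed

end

lemma graph_mod_graph:
  assumes "graph \<Gamma>" "prime p"
  shows "graph_mod p (verts \<Gamma>) (arcs_ends \<Gamma>)"
proof -
  interpret graph \<Gamma> by fact
  show ?thesis
    using assms(2) sym_arcs no_loops
    by unfold_locales (auto simp: arcs_ends_conv symmetric_def sym_def)
qed

theorem theorem4:
  fixes \<Gamma> :: "('a, 'b) pre_digraph" and \<Gamma>' :: "('c, 'd) pre_digraph" and p :: nat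
  assumes "graph \<Gamma>" and "graph \<Gamma>'" and "prime p"
  shows "topological_groups_isomorphic
      (pro_p_completion p (raag \<Gamma>)) (pro_p_topology p (raag \<Gamma>))
      (pro_p_completion p (raag \<Gamma>')) (pro_p_topology p (raag \<Gamma>'))
    \<longleftrightarrow> digraph_iso \<Gamma> \<Gamma>'"
proof
  interpret G: graph \<Gamma> by fact
  interpret H: graph \<Gamma>' by fact
  let ?C = "pro_p_completion p (raag \<Gamma>)" and ?C' = "pro_p_completion p (raag \<Gamma>')"
  interpret C: group ?C by (intro group_pro_p_completion group_raag)
  interpret C': group ?C' by (intro group_pro_p_completion group_raag)
  assume "topological_groups_isomorphic ?C (pro_p_topology p (raag \<Gamma>))
      ?C' (pro_p_topology p (raag \<Gamma>'))"
  then obtain f g where f: "f \<in> hom ?C ?C'"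
    and fg: "homeomorphic_maps (pro_p_topology p (raag \<Gamma>)) (pro_p_topology p (raag \<Gamma>')) f g"
    unfolding topological_groups_isomorphic_def homeomorphic_map_maps iso_def by blast
  have gf: "\<And>x. x \<in> carrier ?C \<Longrightarrow> g (f x) = x" and fg': "\<And>y. y \<in> carrier ?C' \<Longrightarrow> f (g y) = y"
    and cont: "continuous_map (pro_p_topology p (raag \<Gamma>)) (pro_p_topology p (raag \<Gamma>')) f"
      "continuous_map (pro_p_topology p (raag \<Gamma>')) (pro_p_topology p (raag \<Gamma>)) g"
    using fg by (auto simp: homeomorphic_maps_def topspace_pro_p_topology)
  have g_closed: "g y \<in> carrier ?C" if "y \<in> carrier ?C'" for y
    using continuous_map_funspace[OF cont(2)] that by (auto simp: topspace_pro_p_topology)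
  \<comment> \<open>The homeomorphism only provides an inverse map; it is multiplicative by applying
    \<open>g\<close> to the product formula for \<open>f\<close>.\<close>
  have g: "g \<in> hom ?C' ?C"
  proof (rule homI)
    fix x y assume xy: "x \<in> carrier ?C'" "y \<in> carrier ?C'"
    have "f (g x \<otimes>\<^bsub>?C\<^esub> g y) = x \<otimes>\<^bsub>?C'\<^esub> y"
      using hom_mult[OF f] xy g_closed fg' by simp
    then show "g (x \<otimes>\<^bsub>?C'\<^esub> y) = g x \<otimes>\<^bsub>?C\<^esub> g y"
      using gf[of "g x \<otimes>\<^bsub>?C\<^esub> g y"] xy g_closed by simp
  qed (rule g_closed)
  interpret F: pro_p_raag_hom p \<Gamma> \<Gamma>' g
    using assms(3) G.wf_digraph_axioms H.wf_digraph_axioms g cont(2) by (simp add: pro_p_raag_hom_def)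
  interpret F': pro_p_raag_hom p \<Gamma>' \<Gamma> f
    using assms(3) G.wf_digraph_axioms H.wf_digraph_axioms f cont(1) by (simp add: pro_p_raag_hom_def)
  interpret M: graph_mod p "verts \<Gamma>" "arcs_ends \<Gamma>" using assms(1,3) by (rule graph_mod_graph)
  interpret M': graph_mod p "verts \<Gamma>'" "arcs_ends \<Gamma>'" using assms(2,3) by (rule graph_mod_graph)
  \<comment> \<open>Transferring along \<open>g\<close> and then along \<open>f\<close> evaluates
    the functional at \<open>g (f x) = x\<close> for a generator \<open>x\<close>.\<close>
  have "[transfer_vec p \<Gamma>' \<Gamma> f (transfer_vec p \<Gamma> \<Gamma>' g a) v = a v] (mod int p)"
    if v: "v \<in> verts \<Gamma>" for a v
    using F.lift_transfer[OF F'.closed[OF v], of a] gf[OF pro_p_gen_closed[OF v]] lift_vec(2)[OF assms(3) v, of a]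
    by (simp add: transfer_vec_def[of p \<Gamma>' \<Gamma>] cong_def)
  moreover have "[transfer_vec p \<Gamma> \<Gamma>' g (transfer_vec p \<Gamma>' \<Gamma> f a) v = a v] (mod int p)"
    if v: "v \<in> verts \<Gamma>'" for a v
    using F'.lift_transfer[OF F.closed[OF v], of a] fg'[OF pro_p_gen_closed[OF v]] lift_vec(2)[OF assms(3) v, of a]
    by (simp add: transfer_vec_def[of p \<Gamma> \<Gamma>'] cong_def)
  ultimately interpret perp_equiv p "verts \<Gamma>" "arcs_ends \<Gamma>" "verts \<Gamma>'" "arcs_ends \<Gamma>'"
    "transfer_vec p \<Gamma> \<Gamma>' g" "transfer_vec p \<Gamma>' \<Gamma> f"
    by unfold_locales
      (auto intro: F.transfer_lin F'.transfer_lin F.transfer_cong F'.transfer_cong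
        F.transfer_perp F'.transfer_perp)
  show "digraph_iso \<Gamma> \<Gamma>'"
    using graphs_isomorphic
      digraph_iso_iff_bij_arcs_ends[OF G.nomulti_digraph_axioms H.nomulti_digraph_axioms] by blast
next
  assume "digraph_iso \<Gamma> \<Gamma>'"
  with assms show "topological_groups_isomorphic
      (pro_p_completion p (raag \<Gamma>)) (pro_p_topology p (raag \<Gamma>))
      (pro_p_completion p (raag \<Gamma>')) (pro_p_topology p (raag \<Gamma>'))"
    by (rule pro_p_completions_isomorphic_if_digraph_iso)
qed

end
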